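(* Let $G$ be a countable discrete group. Then $G$ is Choquet-Deny if and only if $G$ has no ICC quotients. Moreover, if $G$ does have an ICC quotient, then there exists a probability measure $\mu$ on $G$ with $\operatorname{supp}\mu = G$, which is symmetric and has finite Shannon entropy, such that $(G,\mu)$ is not Liouville. In particular, if $G$ is finitely generated, then $G$ is Choquet-Deny if and only if $G$ is virtually nilpotent.
   Context: A probability measure $\mu$ on a countable discrete group $G$ is non-degenerate if its support generates $G$ as a semigroup. A function $f\colon G\to\mathbb{R}$ is $\mu$-harmonic if $f(k)=\sum_{g\in G}\mu(g)f(kg)$ for all $k\in G$. The pair $(G,\mu)$ is Liouville if every bounded $\mu$-harmonic function is constant (equivalently, the Poisson boundary of $(G,\mu)$ is trivial). $G$ is called Choquet-Deny if $(G,\mu)$ is Liouville for every non-degenerate probability measure $\mu$ on $G$. A group has the infinite conjugacy class property (ICC) if it is non-trivial and every non-identity element has an infinite conjugacy class. $\mu$ is symmetric if $\mu(g)=\mu(g^{-1})$ for all $g$; its Shannon entropy is $H(\mu)=-\sum_{g}\mu(g)\log\mu(g)$. *)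

theory Defs
  imports "HOL-Analysis.Analysis" "HOL-Algebra.Algebra"
begin

text \<open>A probability measure on the (countable, discrete) group G, given by its mass function.
  Values outside the carrier are irrelevant.\<close>
definition prob_measure_on :: "('a, 'b) monoid_scheme \<Rightarrow> ('a \<Rightarrow> real) \<Rightarrow> bool" where
  "prob_measure_on G \<mu> \<longleftrightarrow> (\<forall>g\<in>carrier G. 0 \<le> \<mu> g) \<and> (\<mu> has_sum 1) (carrier G)"

definition msupp :: "('a, 'b) monoid_scheme \<Rightarrow> ('a \<Rightarrow> real) \<Rightarrow> 'a set" where
  "msupp G \<mu> = {g \<in> carrier G. \<mu> g > 0}"

definition semigroup_generated :: "('a, 'b) monoid_scheme \<Rightarrow> 'a set \<Rightarrow> 'a set" where
  "semigroup_generated G S =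
     {foldr (\<otimes>\<^bsub>G\<^esub>) xs \<one>\<^bsub>G\<^esub> | xs. xs \<noteq> [] \<and> set xs \<subseteq> S}"

definition non_degenerate :: "('a, 'b) monoid_scheme \<Rightarrow> ('a \<Rightarrow> real) \<Rightarrow> bool" where
  "non_degenerate G \<mu> \<longleftrightarrow> semigroup_generated G (msupp G \<mu>) = carrier G"

definition harmonic :: "('a, 'b) monoid_scheme \<Rightarrow> ('a \<Rightarrow> real) \<Rightarrow> ('a \<Rightarrow> real) \<Rightarrow> bool" where
  "harmonic G \<mu> f \<longleftrightarrow>
     (\<forall>k\<in>carrier G. ((\<lambda>g. \<mu> g * f (k \<otimes>\<^bsub>G\<^esub> g)) has_sum f k) (carrier G))"

definition bounded_on :: "('a, 'b) monoid_scheme \<Rightarrow> ('a \<Rightarrow> real) \<Rightarrow> bool" where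
  "bounded_on G f \<longleftrightarrow> (\<exists>B. \<forall>g\<in>carrier G. \<bar>f g\<bar> \<le> B)"

definition liouville :: "('a, 'b) monoid_scheme \<Rightarrow> ('a \<Rightarrow> real) \<Rightarrow> bool" where
  "liouville G \<mu> \<longleftrightarrow>
     (\<forall>f. bounded_on G f \<and> harmonic G \<mu> f \<longrightarrow> (\<forall>x\<in>carrier G. \<forall>y\<in>carrier G. f x = f y))"

definition choquet_deny :: "('a, 'b) monoid_scheme \<Rightarrow> bool" where
  "choquet_deny G \<longleftrightarrow>
     (\<forall>\<mu>. prob_measure_on G \<mu> \<and> non_degenerate G \<mu> \<longrightarrow> liouville G \<mu>)"

definition symmetric_measure :: "('a, 'b) monoid_scheme \<Rightarrow> ('a \<Rightarrow> real) \<Rightarrow> bool" where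
  "symmetric_measure G \<mu> \<longleftrightarrow> (\<forall>g\<in>carrier G. \<mu> g = \<mu> (inv\<^bsub>G\<^esub> g))"

text \<open>Finite Shannon entropy: the series of \<open>-\<mu> g log \<mu> g\<close> (nonnegative terms, with 0 log 0 = 0) converges.\<close>
definition finite_entropy :: "('a, 'b) monoid_scheme \<Rightarrow> ('a \<Rightarrow> real) \<Rightarrow> bool" where
  "finite_entropy G \<mu> \<longleftrightarrow> (\<lambda>g. - (\<mu> g * ln (\<mu> g))) summable_on (carrier G)"

definition conj_class :: "('a, 'b) monoid_scheme \<Rightarrow> 'a \<Rightarrow> 'a set" where
  "conj_class H x = {inv\<^bsub>H\<^esub> h \<otimes>\<^bsub>H\<^esub> x \<otimes>\<^bsub>H\<^esub> h | h. h \<in> carrier H}"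

definition icc :: "('a, 'b) monoid_scheme \<Rightarrow> bool" where
  "icc H \<longleftrightarrow> carrier H \<noteq> {\<one>\<^bsub>H\<^esub>} \<and>
     (\<forall>x\<in>carrier H. x \<noteq> \<one>\<^bsub>H\<^esub> \<longrightarrow> infinite (conj_class H x))"

definition has_icc_quotient :: "('a, 'b) monoid_scheme \<Rightarrow> bool" where
  "has_icc_quotient G \<longleftrightarrow> (\<exists>N. N \<lhd> G \<and> icc (G Mod N))"

fun lower_central :: "('a, 'b) monoid_scheme \<Rightarrow> nat \<Rightarrow> 'a set" where
  "lower_central G 0 = carrier G"
| "lower_central G (Suc n) = generate G
     {x \<otimes>\<^bsub>G\<^esub> y \<otimes>\<^bsub>G\<^esub> inv\<^bsub>G\<^esub> x \<otimes>\<^bsub>G\<^esub> inv\<^bsub>G\<^esub> y | x y. x \<in> carrier G \<and> y \<in> lower_central G n}"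

definition nilpotent_group :: "('a, 'b) monoid_scheme \<Rightarrow> bool" where
  "nilpotent_group G \<longleftrightarrow> group G \<and> (\<exists>n. lower_central G n = {\<one>\<^bsub>G\<^esub>})"

definition virtually_nilpotent :: "('a, 'b) monoid_scheme \<Rightarrow> bool" where
  "virtually_nilpotent G \<longleftrightarrow>
     (\<exists>H. subgroup H G \<and> finite (rcosets\<^bsub>G\<^esub> H) \<and> nilpotent_group (G\<lparr>carrier := H\<rparr>))"

definition finitely_generated :: "('a, 'b) monoid_scheme \<Rightarrow> bool" where
  "finitely_generated G \<longleftrightarrow> (\<exists>S. finite S \<and> S \<subseteq> carrier G \<and> generate G S = carrier G)"

end

theory Submission
  imports Defs
begin

text \<open>If all bounded harmonic functions are invariant under a normal subgroup \<open>N\<close>, and \<open>z\<close> has only finitely many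
  conjugates modulo \<open>N\<close>, then they are also invariant under translation by \<open>z\<close>: a near-maximum of \<open>k \<mapsto> f (z k) - f k\<close> propagates along powers, where the
  increments telescope. So the group of translations fixing all bounded harmonic functions is everything unless some quotient is ICC.

  Conversely, an ICC group contains elements \<open>q\<^sub>0, q\<^sub>1, \<dots>\<close> such that \<open>q\<^sub>k\<close> conjugates long words in the earlier letters
  away from each other. For a step distribution on the letters \<open>q\<^sub>k\<^sup>\<plusminus>\<^sup>1\<close> with a polynomial tail, the position of the walk
  determines, with high probability at all times, the position just before the largest letter so far, hence by recursion the
  starting point. This is expressed without a path space: an explicit bound on the probability of ever leaving the good
  configurations is superharmonic, the bounds for two starting points have sum at least \<open>1\<close>, and Perron's method yields a
  harmonic function in between.

  In the finitely generated case, a normal subgroup maximal among those with a quotient that is not virtually nilpotent leads to a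
  contradiction, since virtual nilpotency passes through finitely generated extensions by FC elements.\<close>

section \<open>Translations by elements with few conjugates\<close>

text \<open>The weights are put on labels, not on group elements. They are fixed before any group is
  given; only the map from labels to letters depends on the group. So the waiting bounds
  \<open>L\<close> can be chosen before the switching elements, whose defining condition involves
  \<open>L\<close>; a walk on the quotient lifts to \<open>G\<close> by lifting its letters; and
  entropy is estimated on the labels.

  Full support forces arbitrary letters into the walk. Below the current maximal level they only
  lengthen a word over a finite alphabet, so noise costs something extra only at a new maximum.
  Symmetry makes \<open>q j\<close> and its inverse occur alike, hence the condition on
  \<open>g x g\<close> next to the one on conjugates.

  A level is at least \<open>k\<close> with probability \<open>16 / (16 + k)\<close>. Among letters
  not below the current maximum \<open>k - 1\<close>, a repetition of it has probability
  \<open>1 / (16 + k)\<close>, and records typically grow by a factor, so the losses at all later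
  records add up to the order of \<open>1 / k\<close>. The offset 16 makes the total less than 1/2
  at the two starting points, which separates the values there.\<close>

lemma has_sum_diff:
  fixes f g :: "'a \<Rightarrow> real"
  assumes "(f has_sum a) A" "(g has_sum b) A"
  shows "((\<lambda>x. f x - g x) has_sum a - b) A"
  using has_sum_add[OF assms(1), of "\<lambda>x. - g x" "- b"] assms(2) by (simp add: has_sum_uminus)

section \<open>ICC quotients in terms of cosets\<close>

lemma (in group) rcos_eq_iff:
  assumes "subgroup N G" "x \<in> carrier G" "y \<in> carrier G"
  shows "N #> x = N #> y \<longleftrightarrow> x \<otimes> inv y \<in> N"
proof
  assume "N #> x = N #> y"
  then have "x \<in> N #> y"
    using rcos_self[OF assms(2,1)] by simp
  then show "x \<otimes> inv y \<in> N"
    using subgroup.rcos_module[OF assms(1) is_group assms(3) assms(2)] by simp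
next
  assume "x \<otimes> inv y \<in> N"
  then have "x \<in> N #> y"
    using subgroup.rcos_module[OF assms(1) is_group assms(3) assms(2)] by simp
  then show "N #> x = N #> y"
    using repr_independence assms(1,3) by metis
qed

lemma (in group) conj_class_Mod:
  assumes "N \<lhd> G" "z \<in> carrier G"
  shows "conj_class (G Mod N) (N #> z) = (\<lambda>k. N #> (inv k \<otimes> z \<otimes> k)) ` carrier G"
proof -
  interpret normal N G by fact
  have inv: "inv\<^bsub>G Mod N\<^esub> (N #> k) = N #> inv k" if "k \<in> carrier G" for k
    using that inv_FactGroup[of "N #> k"] by (simp add: carrier_FactGroup rcos_inv)
  have "inv\<^bsub>G Mod N\<^esub> (N #> k) \<otimes>\<^bsub>G Mod N\<^esub> (N #> z) \<otimes>\<^bsub>G Mod N\<^esub> (N #> k) = N #> (inv k \<otimes> z \<otimes> k)"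
    if "k \<in> carrier G" for k
    using that assms inv[OF that] by (simp add: rcos_sum)
  then show ?thesis
    unfolding conj_class_def carrier_FactGroup by (auto simp: image_iff)
qed

lemma (in group) icc_Mod_iff:
  assumes "N \<lhd> G"
  shows "icc (G Mod N) \<longleftrightarrow> N \<noteq> carrier G \<and>
    (\<forall>z\<in>carrier G - N. infinite ((\<lambda>k. N #> (inv k \<otimes> z \<otimes> k)) ` carrier G))"
proof -
  interpret normal N G by fact
  have one: "N #> z = N \<longleftrightarrow> z \<in> N" if "z \<in> carrier G" for z
    using rcos_eq_iff[OF normal_imp_subgroup[OF assms] that monoid.one_closed[OF is_monoid]] that by (simp add: coset_mult_one subset)
  have "carrier (G Mod N) = {N} \<longleftrightarrow> N = carrier G"
  proof -
    have "carrier (G Mod N) = {N} \<longleftrightarrow> (\<forall>z\<in>carrier G. N #> z = N)"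
      unfolding carrier_FactGroup using monoid.one_closed[OF is_monoid] by blast
    then show ?thesis using one subset by (metis subset_antisym subsetI subsetD)
  qed
  moreover have "(\<forall>x\<in>carrier (G Mod N). x \<noteq> N \<longrightarrow> infinite (conj_class (G Mod N) x)) \<longleftrightarrow>
     (\<forall>z\<in>carrier G - N. infinite ((\<lambda>k. N #> (inv k \<otimes> z \<otimes> k)) ` carrier G))"
    unfolding carrier_FactGroup using one conj_class_Mod[OF assms] by auto
  ultimately show ?thesis by (simp add: icc_def)
qed

text \<open>The defects \<open>M - h\<close> are nonnegative and averaged by \<open>\<mu>\<close>,
  so one step by \<open>s\<close> enlarges a defect at most by the factor
  \<open>1 / \<mu> s\<close>. What matters later is that \<open>K\<close> depends on
  \<open>g\<close> only, neither on \<open>\<delta>\<close> nor on \<open>k\<close>.\<close>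

lemma (in group) harmonic_near_max_propagates:
  assumes \<mu>: "prob_measure_on G \<mu>" and h: "harmonic G \<mu> h"
    and M: "\<And>k. k \<in> carrier G \<Longrightarrow> h k \<le> M" and g: "g \<in> semigroup_generated G (msupp G \<mu>)"
  shows "\<exists>K\<ge>0. \<forall>\<delta>. \<forall>k\<in>carrier G. M - \<delta> \<le> h k \<longrightarrow> M - K * \<delta> \<le> h (k \<otimes> g)"
proof -
  have step: "M - \<delta> / \<mu> s \<le> h (k \<otimes> s)"
    if s: "s \<in> msupp G \<mu>" and k: "k \<in> carrier G" and d: "M - \<delta> \<le> h k" for s k \<delta>
  proof -
    have "((\<lambda>g. \<mu> g * M) has_sum 1 * M) (carrier G)"
      using \<mu> by (intro has_sum_cmult_left) (simp add: prob_measure_on_def)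
    then have "((\<lambda>g. \<mu> g * M - \<mu> g * h (k \<otimes> g)) has_sum 1 * M - h k) (carrier G)"
      using h k unfolding harmonic_def by (intro has_sum_diff) auto
    then have "sum (\<lambda>g. \<mu> g * M - \<mu> g * h (k \<otimes> g)) {s} \<le> 1 * M - h k"
      by (rule finite_sum_le_has_sum)
        (use s k M \<mu> in \<open>auto simp: msupp_def prob_measure_on_def intro!: mult_left_mono\<close>)
    with d have "\<mu> s * (M - h (k \<otimes> s)) \<le> \<delta>" by (simp add: algebra_simps)
    moreover have "\<mu> s > 0" using s by (simp add: msupp_def)
    ultimately show ?thesis by (simp add: field_simps)
  qed
  obtain xs where xs: "g = foldr (\<otimes>) xs \<one>" "set xs \<subseteq> msupp G \<mu>"
    using g unfolding semigroup_generated_def by auto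
  have "\<exists>K\<ge>0. \<forall>\<delta>. \<forall>k\<in>carrier G. M - \<delta> \<le> h k \<longrightarrow> M - K * \<delta> \<le> h (k \<otimes> foldr (\<otimes>) xs \<one>)"
    using xs(2)
  proof (induction xs)
    case Nil
    then show ?case by (intro exI[of _ 1]) auto
  next
    case (Cons s xs)
    then obtain K where K: "K \<ge> 0" "\<And>\<delta> k. k \<in> carrier G \<Longrightarrow> M - \<delta> \<le> h k \<Longrightarrow>
        M - K * \<delta> \<le> h (k \<otimes> foldr (\<otimes>) xs \<one>)" by auto
    have s: "s \<in> msupp G \<mu>" "s \<in> carrier G" "\<mu> s > 0" using Cons.prems by (auto simp: msupp_def)
    have c: "foldr (\<otimes>) xs \<one> \<in> carrier G"
      using Cons.prems by (induction xs) (auto simp: msupp_def)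
    show ?case
    proof (intro exI[of _ "K / \<mu> s"] conjI allI ballI impI)
      show "0 \<le> K / \<mu> s" using K s by simp
      fix \<delta> k assume k: "k \<in> carrier G" and "M - \<delta> \<le> h k"
      then have "M - \<delta> / \<mu> s \<le> h (k \<otimes> s)" using step s by blast
      then have "M - K * (\<delta> / \<mu> s) \<le> h (k \<otimes> s \<otimes> foldr (\<otimes>) xs \<one>)"
        using K(2)[of "k \<otimes> s" "\<delta> / \<mu> s"] k s by simp
      then show "M - K / \<mu> s * \<delta> \<le> h (k \<otimes> foldr (\<otimes>) (s # xs) \<one>)"
        using k s c by (simp add: m_assoc)
    qed
  qed
  then show ?thesis using xs(1) by simp
qed

lemma (in group) harmonic_translate:
  assumes "harmonic G \<mu> f" "z \<in> carrier G"
  shows "harmonic G \<mu> (\<lambda>k. f (z \<otimes> k))"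
  unfolding harmonic_def
proof
  fix k assume k: "k \<in> carrier G"
  have "((\<lambda>g. \<mu> g * f (z \<otimes> k \<otimes> g)) has_sum f (z \<otimes> k)) (carrier G)"
    using assms k unfolding harmonic_def by auto
  then show "((\<lambda>g. \<mu> g * f (z \<otimes> (k \<otimes> g))) has_sum f (z \<otimes> k)) (carrier G)"
    by (rule has_sum_cong[THEN iffD1, rotated]) (use assms k in \<open>auto simp: m_assoc\<close>)
qed

text \<open>If \<open>z k = k c\<close> modulo \<open>N\<close>, then a near-maximum of \<open>k \<mapsto> f (z k) - f k\<close> at \<open>k\<close> persists at
  \<open>k, k c, k c\<^sup>2, \<dots>\<close>; these increments of \<open>f\<close> telescope, so a positive supremum would make
  \<open>f\<close> unbounded. Finitely many \<open>c\<close> suffice, which makes the estimate uniform in \<open>k\<close>.\<close>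
lemma (in group) fc_translate_le:
  assumes \<mu>: "prob_measure_on G \<mu>" "non_degenerate G \<mu>" and N: "N \<lhd> G"
    and f: "harmonic G \<mu> f" "bounded_on G f"
    and fN: "\<And>x y. x \<in> carrier G \<Longrightarrow> y \<in> carrier G \<Longrightarrow> N #> x = N #> y \<Longrightarrow> f x = f y"
    and z: "z \<in> carrier G" "finite ((\<lambda>k. N #> (inv k \<otimes> z \<otimes> k)) ` carrier G)"
    and k0: "k0 \<in> carrier G"
  shows "f (z \<otimes> k0) \<le> f k0"
proof (rule ccontr)
  assume neg: "\<not> f (z \<otimes> k0) \<le> f k0"
  interpret normal N G by fact
  define h where "h k = f (z \<otimes> k) - f k" for k
  obtain B where B: "\<And>g. g \<in> carrier G \<Longrightarrow> \<bar>f g\<bar> \<le> B" using f(2) unfolding bounded_on_def by auto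
  have hB: "h k \<le> 2 * B" if "k \<in> carrier G" for k
    using B[of k] B[of "z \<otimes> k"] that z(1) by (auto simp: h_def)
  have bdd: "bdd_above (h ` carrier G)" using hB by (auto intro!: bdd_aboveI)
  define M where "M = Sup (h ` carrier G)"
  have hM: "h k \<le> M" if "k \<in> carrier G" for k
    unfolding M_def using that bdd by (intro cSup_upper) auto
  have M: "M > 0" using neg hM[OF k0] by (auto simp: h_def)
  have hh: "harmonic G \<mu> h"
    using f(1) harmonic_translate[OF f(1) z(1)] unfolding harmonic_def h_def
    by (auto simp: right_diff_distrib intro!: has_sum_diff)
  \<comment> \<open>\<open>n\<close> increments of size \<open>M / 2\<close> exceed
    \<open>2 * B\<close>, the largest possible oscillation of \<open>f\<close>.\<close>
  obtain n :: nat where n: "4 * B < of_nat n * M" using M reals_Archimedean3 by blast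
  obtain F where F: "finite F" "F \<subseteq> carrier G"
    "\<And>k. k \<in> carrier G \<Longrightarrow> \<exists>c\<in>F. N #> (inv k \<otimes> z \<otimes> k) = N #> c"
  proof -
    obtain K where "finite K" "K \<subseteq> carrier G" and
      K: "(\<lambda>k. N #> (inv k \<otimes> z \<otimes> k)) ` K = (\<lambda>k. N #> (inv k \<otimes> z \<otimes> k)) ` carrier G"
      using finite_subset_image[OF z(2) subset_refl] by metis
    show thesis
    proof (rule that[of "(\<lambda>k. inv k \<otimes> z \<otimes> k) ` K"])
      show "\<exists>c\<in>(\<lambda>k. inv k \<otimes> z \<otimes> k) ` K. N #> (inv k \<otimes> z \<otimes> k) = N #> c" if "k \<in> carrier G" for k
      proof -
        have "N #> (inv k \<otimes> z \<otimes> k) \<in> (\<lambda>k. N #> (inv k \<otimes> z \<otimes> k)) ` K"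
          unfolding K using that by blast
        then show ?thesis by blast
      qed
    qed (use \<open>finite K\<close> \<open>K \<subseteq> carrier G\<close> z in auto)
  qed
  define P where "P = (\<lambda>(c, j::nat). c [^] j) ` (F \<times> {..n})"
  have P: "finite P" "P \<subseteq> carrier G" using F by (auto simp: P_def)
  have "\<forall>g\<in>P. \<exists>K\<ge>0. \<forall>\<delta>. \<forall>k\<in>carrier G. M - \<delta> \<le> h k \<longrightarrow> M - K * \<delta> \<le> h (k \<otimes> g)"
    using harmonic_near_max_propagates[OF \<mu>(1) hh hM] \<mu>(2) P(2) unfolding non_degenerate_def by blast
  then obtain K where K: "\<And>g. g \<in> P \<Longrightarrow> K g \<ge> 0" "\<And>g \<delta> k. g \<in> P \<Longrightarrow> k \<in> carrier G \<Longrightarrow>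
      M - \<delta> \<le> h k \<Longrightarrow> M - K g * \<delta> \<le> h (k \<otimes> g)" by metis
  \<comment> \<open>\<open>sum K P\<close> dominates every \<open>K g\<close>, so one near-maximum
    \<open>k\<close> keeps at least \<open>M / 2\<close> at all \<open>k \<otimes> g\<close> with
    \<open>g \<in> P\<close>; the added 1 keeps the divisor positive.\<close>
  define \<delta> where "\<delta> = M / (2 * (sum K P + 1))"
  have sK: "sum K P \<ge> 0" using K(1) by (simp add: sum_nonneg)
  then have \<delta>: "\<delta> > 0" using M by (simp add: \<delta>_def)
  have "\<exists>k\<in>carrier G. M - \<delta> < h k"
    using less_cSup_iff[of "h ` carrier G" "M - \<delta>"] bdd \<delta> one_closed unfolding M_def by auto
  then obtain k where k: "k \<in> carrier G" "M - \<delta> \<le> h k" by force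
  have half: "M / 2 \<le> h (k \<otimes> g)" if "g \<in> P" for g
  proof -
    have "K g \<le> sum K P" using that P K by (meson member_le_sum DiffD1)
    then have "K g * \<delta> \<le> sum K P * \<delta>" using \<delta> by simp
    also have "\<dots> \<le> M / 2" using sK M unfolding \<delta>_def by (simp add: field_simps)
    finally show ?thesis using K(2)[OF that k] by linarith
  qed
  obtain c where c: "c \<in> F" "N #> (inv k \<otimes> z \<otimes> k) = N #> c" using F(3) k by blast
  have cG: "c \<in> carrier G" using c F by auto
  have "N #> (z \<otimes> k) = (N #> k) <#> (N #> (inv k \<otimes> z \<otimes> k))"
    using k z by (simp add: rcos_sum m_assoc[symmetric])
  also have "\<dots> = N #> (k \<otimes> c)" using c k cG by (simp add: rcos_sum)
  finally have zk: "N #> (z \<otimes> k) = N #> (k \<otimes> c)" .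
  have zj: "N #> (z [^] j \<otimes> k) = N #> (k \<otimes> c [^] j)" for j :: nat
  proof (induction j)
    case (Suc j)
    have "N #> (z [^] Suc j \<otimes> k) = (N #> (z [^] j)) <#> (N #> (z \<otimes> k))"
      using k z by (simp add: rcos_sum m_assoc)
    also have "\<dots> = (N #> (z [^] j \<otimes> k)) <#> (N #> c)"
      using k z cG zk by (simp add: rcos_sum m_assoc)
    also have "\<dots> = N #> (k \<otimes> c [^] Suc j)" using Suc k z cG by (simp add: rcos_sum m_assoc)
    finally show ?case .
  qed (use k in simp)
  have incr: "M / 2 \<le> f (z [^] Suc j \<otimes> k) - f (z [^] j \<otimes> k)" if "j \<le> n" for j
  proof -
    have "N #> (z \<otimes> (k \<otimes> c [^] j)) = (N #> z) <#> (N #> (z [^] j \<otimes> k))"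
      using zj[of j] k z cG by (simp add: rcos_sum)
    also have "\<dots> = N #> (z \<otimes> z [^] j \<otimes> k)" using k z by (simp add: rcos_sum m_assoc)
    also have "z \<otimes> z [^] j = z [^] Suc j" using z by (metis nat_pow_Suc2)
    finally have "N #> (z \<otimes> (k \<otimes> c [^] j)) = N #> (z [^] Suc j \<otimes> k)" .
    then have "f (z \<otimes> (k \<otimes> c [^] j)) = f (z [^] Suc j \<otimes> k)"
      using k z cG by (intro fN) auto
    moreover have "f (k \<otimes> c [^] j) = f (z [^] j \<otimes> k)"
      using k z cG zj by (intro fN) auto
    moreover have "c [^] j \<in> P" using c that by (auto simp: P_def)
    ultimately show ?thesis using half unfolding h_def by metis
  qed
  have "of_nat n * (M / 2) = (\<Sum>j<n. M / 2)" by simp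
  also have "\<dots> \<le> (\<Sum>j<n. f (z [^] Suc j \<otimes> k) - f (z [^] j \<otimes> k))"
    by (intro sum_mono incr) auto
  also have "\<dots> = f (z [^] n \<otimes> k) - f (z [^] (0::nat) \<otimes> k)"
    by (rule sum_lessThan_telescope)
  also have "\<dots> \<le> 2 * B"
    using B[of "z [^] n \<otimes> k"] B[of "z [^] (0::nat) \<otimes> k"] k z(1) by fastforce
  finally show False using n by simp
qed

text \<open>The subgroup \<open>N\<close> of undetected left translations is normal because left
  translates of bounded harmonic functions are again such functions. Invariance under
  \<open>N\<close> makes them functions of the coset, as \<open>fc_translate_le\<close>
  requires.\<close>

lemma (in group) no_icc_quotient_imp_choquet_deny:
  assumes "\<not> has_icc_quotient G"
  shows "choquet_deny G"
  unfolding choquet_deny_def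
proof (intro allI impI, elim conjE)
  fix \<mu> assume \<mu>: "prob_measure_on G \<mu>" "non_degenerate G \<mu>"
  define N where "N = {z \<in> carrier G. \<forall>f. bounded_on G f \<and> harmonic G \<mu> f \<longrightarrow>
                        (\<forall>k\<in>carrier G. f (z \<otimes> k) = f k)}"
  have ND: "f (z \<otimes> k) = f k"
    if "z \<in> N" "bounded_on G f" "harmonic G \<mu> f" "k \<in> carrier G" for f z k
    using that unfolding N_def by auto
  have NI: "z \<in> N" if "z \<in> carrier G"
    "\<And>f k. bounded_on G f \<Longrightarrow> harmonic G \<mu> f \<Longrightarrow> k \<in> carrier G \<Longrightarrow> f (z \<otimes> k) = f k" for z
    using that unfolding N_def by auto
  have NG: "N \<subseteq> carrier G" unfolding N_def by auto
  have sub: "subgroup N G"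
  proof (rule subgroupI)
    show "inv a \<in> N" if "a \<in> N" for a
    proof (rule NI)
      fix f k assume "bounded_on G f" "harmonic G \<mu> f" "k \<in> carrier G"
      then show "f (inv a \<otimes> k) = f k"
        using ND[OF that, of f "inv a \<otimes> k"] that NG by (auto simp: m_assoc[symmetric])
    qed (use that NG in auto)
    show "a \<otimes> b \<in> N" if "a \<in> N" "b \<in> N" for a b
    proof (rule NI)
      fix f k assume "bounded_on G f" "harmonic G \<mu> f" "k \<in> carrier G"
      then show "f (a \<otimes> b \<otimes> k) = f k"
        using ND[OF that(1), of f "b \<otimes> k"] ND[OF that(2), of f k] that NG by (auto simp: m_assoc subset_iff)
    qed (use that NG in auto)
    have "\<one> \<in> N" by (rule NI) auto
    then show "N \<noteq> {}" by auto
  qed (use NG in auto)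
  have N: "N \<lhd> G"
  proof (rule normal_invI[OF sub])
    fix x z assume x: "x \<in> carrier G" and z: "z \<in> N"
    show "x \<otimes> z \<otimes> inv x \<in> N"
    proof (rule NI)
      fix f k assume f: "bounded_on G f" "harmonic G \<mu> f" and k: "k \<in> carrier G"
      have "bounded_on G (\<lambda>k. f (x \<otimes> k))" using f(1) x unfolding bounded_on_def by blast
      then have "f (x \<otimes> (z \<otimes> (inv x \<otimes> k))) = f (x \<otimes> (inv x \<otimes> k))"
        using ND[OF z _ harmonic_translate[OF f(2) x], of "inv x \<otimes> k"] x k by auto
      then show "f (x \<otimes> z \<otimes> inv x \<otimes> k) = f k"
        using x z k NG by (simp add: m_assoc[symmetric] subset_iff)
    qed (use x z NG in auto)
  qed
  have "N = carrier G"
  proof (rule ccontr)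
    assume "N \<noteq> carrier G"
    then obtain z where z: "z \<in> carrier G - N" "finite ((\<lambda>k. N #> (inv k \<otimes> z \<otimes> k)) ` carrier G)"
      using assms N icc_Mod_iff[OF N] unfolding has_icc_quotient_def by blast
    have le: "f (z \<otimes> k) \<le> f k" if f: "bounded_on G f" "harmonic G \<mu> f" and k: "k \<in> carrier G" for f k
    proof (rule fc_translate_le[OF \<mu> N f(2,1) _ _ z(2) k])
      fix x y assume xy: "x \<in> carrier G" "y \<in> carrier G" "N #> x = N #> y"
      then have "x \<otimes> inv y \<in> N" using rcos_eq_iff[OF sub] by blast
      then show "f x = f y" using ND[of "x \<otimes> inv y" f y] f xy by (auto simp: m_assoc)
    qed (use z in auto)
    have "z \<in> N"
    proof (rule NI)
      fix f k assume f: "bounded_on G f" "harmonic G \<mu> f" and k: "k \<in> carrier G"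
      \<comment> \<open>\<open>le\<close> applied to \<open>- f\<close> is the reverse
        inequality.\<close>
      have "bounded_on G (\<lambda>x. - f x)" "harmonic G \<mu> (\<lambda>x. - f x)"
        using f unfolding bounded_on_def harmonic_def by (auto simp: has_sum_uminus)
      then show "f (z \<otimes> k) = f k" using le[OF f k] le[of "\<lambda>x. - f x" k] k by simp
    qed (use z in auto)
    with z show False by simp
  qed
  then show "liouville G \<mu>" unfolding liouville_def
    using ND[of _ _ "\<one>"] by (metis one_closed r_one)
qed

section \<open>Virtual nilpotency\<close>

lemma (in group) lower_central_subset: "lower_central G n \<subseteq> carrier G"
proof (induction n)
  case (Suc n)
  show ?case unfolding lower_central.simps by (rule generate_incl) (use Suc in blast)
qed simp

lemma (in group) one_in_lower_central: "\<one> \<in> lower_central G n"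
  by (cases n) (auto intro: generate.one)

lemma (in group) commutator_in_lower_central:
  assumes "x \<in> carrier G" "y \<in> lower_central G n"
  shows "x \<otimes> y \<otimes> inv x \<otimes> inv y \<in> lower_central G (Suc n)"
  unfolding lower_central.simps by (rule generate.incl) (use assms in blast)

lemma (in group) lower_central_Suc_least:
  assumes "subgroup N G"
    and "\<And>x y. x \<in> carrier G \<Longrightarrow> y \<in> lower_central G n \<Longrightarrow> x \<otimes> y \<otimes> inv x \<otimes> inv y \<in> N"
  shows "lower_central G (Suc n) \<subseteq> N"
  unfolding lower_central.simps by (rule generate_subgroup_incl[OF _ assms(1)]) (use assms in blast)

lemma (in group) lower_central_subgroup_Suc:
  assumes "subgroup H G"
  shows "lower_central (G\<lparr>carrier := H\<rparr>) (Suc n) =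
    generate G {x \<otimes> y \<otimes> inv x \<otimes> inv y | x y. x \<in> H \<and> y \<in> lower_central (G\<lparr>carrier := H\<rparr>) n}"
proof -
  interpret K: group "G\<lparr>carrier := H\<rparr>" by (rule subgroup_imp_group[OF assms])
  let ?A = "{x \<otimes> y \<otimes> inv x \<otimes> inv y | x y. x \<in> H \<and> y \<in> lower_central (G\<lparr>carrier := H\<rparr>) n}"
  have sub: "lower_central (G\<lparr>carrier := H\<rparr>) n \<subseteq> H"
    using K.lower_central_subset[of n] by simp
  have "{x \<otimes>\<^bsub>G\<lparr>carrier := H\<rparr>\<^esub> y \<otimes>\<^bsub>G\<lparr>carrier := H\<rparr>\<^esub> inv\<^bsub>G\<lparr>carrier := H\<rparr>\<^esub> x \<otimes>\<^bsub>G\<lparr>carrier := H\<rparr>\<^esub> inv\<^bsub>G\<lparr>carrier := H\<rparr>\<^esub> y |x y.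
      x \<in> carrier (G\<lparr>carrier := H\<rparr>) \<and> y \<in> lower_central (G\<lparr>carrier := H\<rparr>) n} = ?A"
    using m_inv_consistent[OF assms] sub by (intro Collect_cong ex_cong1) auto
  moreover have "?A \<subseteq> H"
    using sub by (auto simp: subset_iff intro!: subgroup.m_closed[OF assms] subgroup.m_inv_closed[OF assms])
  ultimately show ?thesis
    using generate_consistent[OF _ assms, of ?A] by simp
qed

lemma (in group) lower_central_subgroup_subset:
  assumes "subgroup H G"
  shows "lower_central (G\<lparr>carrier := H\<rparr>) n \<subseteq> H"
  using group.lower_central_subset[OF subgroup_imp_group[OF assms]] by simp

lemma (in group) lower_central_subgroup_least:
  assumes "subgroup H G" "subgroup N G"
    and "\<And>x y. x \<in> H \<Longrightarrow> y \<in> lower_central (G\<lparr>carrier := H\<rparr>) n \<Longrightarrow> x \<otimes> y \<otimes> inv x \<otimes> inv y \<in> N"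
  shows "lower_central (G\<lparr>carrier := H\<rparr>) (Suc n) \<subseteq> N"
  unfolding lower_central_subgroup_Suc[OF assms(1)]
  by (rule generate_subgroup_incl[OF _ assms(2)]) (use assms(3) in blast)

lemma (in group) lower_central_subgroup_mono:
  assumes "subgroup H G" "subgroup H' G" "H \<subseteq> H'"
  shows "lower_central (G\<lparr>carrier := H\<rparr>) n \<subseteq> lower_central (G\<lparr>carrier := H'\<rparr>) n"
proof (induction n)
  case (Suc n)
  show ?case
    unfolding lower_central_subgroup_Suc[OF assms(1)] lower_central_subgroup_Suc[OF assms(2)]
    by (rule mono_generate) (use Suc assms(3) in blast)
qed (use assms in simp)

text \<open>For finite \<open>S\<close> these sets are finite, while the commutator sets in
  \<open>lower_central\<close> need not be. They test nilpotency of a given class by finitely many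
  relations.\<close>

fun left_normed_commutators :: "('a, 'b) monoid_scheme \<Rightarrow> 'a set \<Rightarrow> nat \<Rightarrow> 'a set" where
  "left_normed_commutators G S 0 = S"
| "left_normed_commutators G S (Suc n) =
    (\<lambda>(x, y). x \<otimes>\<^bsub>G\<^esub> y \<otimes>\<^bsub>G\<^esub> inv\<^bsub>G\<^esub> x \<otimes>\<^bsub>G\<^esub> inv\<^bsub>G\<^esub> y) ` (S \<times> left_normed_commutators G S n)"

lemma finite_left_normed_commutators:
  "finite S \<Longrightarrow> finite (left_normed_commutators G S n)"
  by (induction n) auto

lemma (in group) left_normed_commutators_subset:
  assumes "S \<subseteq> carrier G"
  shows "left_normed_commutators G S n \<subseteq> lower_central G n"
proof (induction n)
  case (Suc n)
  show ?case
  proof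
    fix w assume "w \<in> left_normed_commutators G S (Suc n)"
    then obtain x y where "x \<in> S" "y \<in> left_normed_commutators G S n" "w = x \<otimes> y \<otimes> inv x \<otimes> inv y"
      by auto
    then show "w \<in> lower_central G (Suc n)"
      using commutator_in_lower_central[of x y n] Suc.IH assms by (simp only:) blast
  qed
qed (use assms in simp)

lemma (in group) commutator_in_normal_iff:
  assumes "N \<lhd> G" "x \<in> carrier G" "y \<in> carrier G"
  shows "x \<otimes> y \<otimes> inv x \<otimes> inv y \<in> N \<longleftrightarrow>
    (N #> x) \<otimes>\<^bsub>G Mod N\<^esub> (N #> y) = (N #> y) \<otimes>\<^bsub>G Mod N\<^esub> (N #> x)"
proof -
  interpret normal N G by fact
  have "x \<otimes> y \<otimes> inv x \<otimes> inv y \<in> N \<longleftrightarrow> N #> (x \<otimes> y) = N #> (y \<otimes> x)"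
    using rcos_eq_iff[OF normal_imp_subgroup[OF assms(1)], of "x \<otimes> y" "y \<otimes> x"] assms(2,3)
    by (simp add: inv_mult_group m_assoc)
  then show ?thesis using assms by (simp add: rcos_sum)
qed

lemma (in group) centralizer_is_subgroup:
  assumes "A \<subseteq> carrier G"
  shows "subgroup {x \<in> carrier G. \<forall>a\<in>A. x \<otimes> a = a \<otimes> x} G"
proof (rule subgroupI)
  fix x assume x: "x \<in> {x \<in> carrier G. \<forall>a\<in>A. x \<otimes> a = a \<otimes> x}"
  have "inv x \<otimes> a = a \<otimes> inv x" if "a \<in> A" for a
  proof -
    have a: "a \<in> carrier G" using that assms by auto
    have "inv x \<otimes> a = inv x \<otimes> (a \<otimes> x) \<otimes> inv x" using x a by (simp add: m_assoc)
    also have "a \<otimes> x = x \<otimes> a" using x that by simp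
    also have "inv x \<otimes> (x \<otimes> a) \<otimes> inv x = a \<otimes> inv x" using x a by (simp add: m_assoc[symmetric])
    finally show ?thesis .
  qed
  then show "inv x \<in> {x \<in> carrier G. \<forall>a\<in>A. x \<otimes> a = a \<otimes> x}" using x by auto
next
  fix x y
  assume x: "x \<in> {x \<in> carrier G. \<forall>a\<in>A. x \<otimes> a = a \<otimes> x}"
    and y: "y \<in> {x \<in> carrier G. \<forall>a\<in>A. x \<otimes> a = a \<otimes> x}"
  have "x \<otimes> y \<otimes> a = a \<otimes> (x \<otimes> y)" if "a \<in> A" for a
  proof -
    have c: "x \<in> carrier G" "y \<in> carrier G" "a \<in> carrier G" using x y that assms by auto
    have "x \<otimes> y \<otimes> a = x \<otimes> (a \<otimes> y)" using c y that by (simp add: m_assoc)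
    also have "\<dots> = a \<otimes> x \<otimes> y" using c x that by (simp flip: m_assoc)
    finally show ?thesis using c by (simp add: m_assoc)
  qed
  then show "x \<otimes> y \<in> {x \<in> carrier G. \<forall>a\<in>A. x \<otimes> a = a \<otimes> x}" using x y by auto
next
  have "\<one> \<in> {x \<in> carrier G. \<forall>a\<in>A. x \<otimes> a = a \<otimes> x}" using assms by auto
  then show "{x \<in> carrier G. \<forall>a\<in>A. x \<otimes> a = a \<otimes> x} \<noteq> {}" by blast
qed auto

lemma (in group) group_hom_Mod:
  assumes "N \<lhd> G"
  shows "group_hom G (G Mod N) (\<lambda>x. N #> x)"
  using normal.factorgroup_is_group[OF assms] normal.r_coset_hom_Mod[OF assms]
  by (simp add: group_hom_def group_hom_axioms_def is_group)

lemma (in group_hom) subgroup_vimage: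
  assumes "subgroup K H"
  shows "subgroup {x \<in> carrier G. h x \<in> K} G"
proof (rule G.subgroupI)
  have "\<one>\<^bsub>G\<^esub> \<in> {x \<in> carrier G. h x \<in> K}" using subgroup.one_closed[OF assms] by simp
  then show "{x \<in> carrier G. h x \<in> K} \<noteq> {}" by blast
qed (auto simp: subgroup.m_closed[OF assms] subgroup.m_inv_closed[OF assms])

lemma (in group) centralizer_mod_is_subgroup:
  assumes "N \<lhd> G" "A \<subseteq> carrier G"
  shows "subgroup {x \<in> carrier G. \<forall>a\<in>A. x \<otimes> a \<otimes> inv x \<otimes> inv a \<in> N} G"
proof -
  interpret h: group_hom G "G Mod N" "\<lambda>x. N #> x" by (rule group_hom_Mod[OF assms(1)])
  have "{x \<in> carrier G. \<forall>a\<in>A. x \<otimes> a \<otimes> inv x \<otimes> inv a \<in> N} = {x \<in> carrier G. N #> x \<in>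
     {v \<in> carrier (G Mod N). \<forall>w\<in>(\<lambda>a. N #> a) ` A. v \<otimes>\<^bsub>G Mod N\<^esub> w = w \<otimes>\<^bsub>G Mod N\<^esub> v}}"
    using commutator_in_normal_iff[OF assms(1)] assms(2) h.hom_closed by (auto simp: subset_iff)
  also have "subgroup \<dots> G"
    by (intro h.subgroup_vimage h.H.centralizer_is_subgroup) (use assms h.hom_closed in blast)
  finally show ?thesis .
qed

lemma (in group) centralizer_mod_sym:
  assumes "N \<lhd> G" "x \<in> carrier G" "y \<in> carrier G"
  shows "x \<otimes> y \<otimes> inv x \<otimes> inv y \<in> N \<longleftrightarrow> y \<otimes> x \<otimes> inv y \<otimes> inv x \<in> N"
  using commutator_in_normal_iff[OF assms] commutator_in_normal_iff[OF assms(1,3,2)] by auto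

lemma (in group) center_mod_is_normal:
  assumes "N \<lhd> G"
  shows "{y \<in> carrier G. \<forall>x\<in>carrier G. x \<otimes> y \<otimes> inv x \<otimes> inv y \<in> N} \<lhd> G" (is "?Z \<lhd> G")
proof -
  have "?Z = {y \<in> carrier G. \<forall>x\<in>carrier G. y \<otimes> x \<otimes> inv y \<otimes> inv x \<in> N}"
    using centralizer_mod_sym[OF assms] by blast
  then have sub: "subgroup ?Z G" using centralizer_mod_is_subgroup[OF assms, of "carrier G"] by simp
  interpret normal N G by fact
  have NZ: "N \<subseteq> ?Z"
  proof
    fix y assume y: "y \<in> N"
    have "x \<otimes> y \<otimes> inv x \<in> N" if "x \<in> carrier G" for x using that y inv_op_closed2 by blast
    then show "y \<in> ?Z" using y by auto
  qed
  show ?thesis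
  proof (rule normal_invI[OF sub])
    fix x y assume x: "x \<in> carrier G" and y: "y \<in> ?Z"
    \<comment> \<open>The conjugate of \<open>y\<close> is this commutator times \<open>y\<close>,
      and the commutator already lies in \<open>N\<close>.\<close>
    then have "x \<otimes> y \<otimes> inv x \<otimes> inv y \<in> ?Z" using NZ by blast
    then have "x \<otimes> y \<otimes> inv x \<otimes> inv y \<otimes> y \<in> ?Z" using y subgroup.m_closed[OF sub] by blast
    then show "x \<otimes> y \<otimes> inv x \<in> ?Z" using x y by (simp add: m_assoc)
  qed
qed

text \<open>The commutators of length \<open>n\<close> in the generators are central modulo \<open>N\<close>, so the induction
  hypothesis applies to the preimage of the center of \<open>G Mod N\<close>.\<close>
lemma (in group) lower_central_subset_if_generators:
  assumes "S \<subseteq> carrier G" "generate G S = carrier G" "N \<lhd> G" "left_normed_commutators G S n \<subseteq> N"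
  shows "lower_central G n \<subseteq> N"
  using assms(3,4)
proof (induction n arbitrary: N)
  case 0
  then show ?case using generate_subgroup_incl[of S N] assms(2) normal_imp_subgroup by auto
next
  case (Suc n)
  let ?Z = "{y \<in> carrier G. \<forall>x\<in>carrier G. x \<otimes> y \<otimes> inv x \<otimes> inv y \<in> N}"
  have "left_normed_commutators G S n \<subseteq> ?Z"
  proof
    fix w assume w: "w \<in> left_normed_commutators G S n"
    then have wG: "w \<in> carrier G"
      using left_normed_commutators_subset[OF assms(1)] lower_central_subset by blast
    have "subgroup {x \<in> carrier G. \<forall>a\<in>{w}. x \<otimes> a \<otimes> inv x \<otimes> inv a \<in> N} G"
      by (rule centralizer_mod_is_subgroup[OF Suc.prems(1)]) (use wG in simp)
    moreover have "S \<subseteq> {x \<in> carrier G. \<forall>a\<in>{w}. x \<otimes> a \<otimes> inv x \<otimes> inv a \<in> N}"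
      using Suc.prems(2) w assms(1) by auto
    ultimately have "generate G S \<subseteq> {x \<in> carrier G. \<forall>a\<in>{w}. x \<otimes> a \<otimes> inv x \<otimes> inv a \<in> N}"
      by (intro generate_subgroup_incl)
    then show "w \<in> ?Z" unfolding assms(2) using wG by auto
  qed
  then have "lower_central G n \<subseteq> ?Z" using Suc.IH center_mod_is_normal Suc.prems(1) by blast
  then show ?case
    using lower_central_Suc_least[OF normal_imp_subgroup[OF Suc.prems(1)], of n] by blast
qed

section \<open>Subgroups of finite index\<close>

lemma (in group) finite_rcosets_iff:
  "finite (rcosets H) \<longleftrightarrow> finite ((\<lambda>g. H #> g) ` carrier G)"
proof -
  have "rcosets H = (\<lambda>g. H #> g) ` carrier G" unfolding RCOSETS_def by auto
  then show ?thesis by simp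
qed

lemma finite_image_factor:
  assumes "finite (f ` A)" "\<And>x y. x \<in> A \<Longrightarrow> y \<in> A \<Longrightarrow> f x = f y \<Longrightarrow> g x = g y"
  shows "finite (g ` A)"
proof -
  have "g ` A \<subseteq> (\<lambda>v. g (SOME x. x \<in> A \<and> f x = v)) ` f ` A"
  proof safe
    fix x assume x: "x \<in> A"
    have "(SOME y. y \<in> A \<and> f y = f x) \<in> A \<and> f (SOME y. y \<in> A \<and> f y = f x) = f x"
      by (rule someI[where P = "\<lambda>y. y \<in> A \<and> f y = f x"]) (use x in simp)
    then have "g x = g (SOME y. y \<in> A \<and> f y = f x)" using assms(2) x by metis
    then show "g x \<in> (\<lambda>v. g (SOME x. x \<in> A \<and> f x = v)) ` f ` A" using x by blast
  qed
  then show ?thesis using assms(1) finite_surj by blast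
qed

lemma (in group) finite_rcosets_Int:
  assumes "subgroup H G" "subgroup K G" "finite (rcosets H)" "finite (rcosets K)"
  shows "finite (rcosets (H \<inter> K))"
  unfolding finite_rcosets_iff
proof (rule finite_image_factor)
  have "(\<lambda>g. (H #> g, K #> g)) ` carrier G \<subseteq> (rcosets H) \<times> (rcosets K)"
    unfolding RCOSETS_def by auto
  then show "finite ((\<lambda>g. (H #> g, K #> g)) ` carrier G)" using assms finite_subset by blast
qed (use rcos_eq_iff assms subgroups_Inter_pair in \<open>auto simp: rcos_eq_iff\<close>)

text \<open>Schreier's lemma: right multiplication by a generator or its inverse maps the product
  set of \<open>K\<close> and \<open>R\<close> into itself, the correction term being an element of
  \<open>U\<close>. So this product set is the whole group.\<close>

lemma (in group) schreier_finitely_generated: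
  assumes "finite S" "S \<subseteq> carrier G" "generate G S = carrier G"
    and H: "subgroup H G" "finite (rcosets H)"
  shows "\<exists>T. finite T \<and> T \<subseteq> H \<and> generate G T = H"
proof -
  obtain R0 where R0: "finite R0" "R0 \<subseteq> carrier G" "(\<lambda>g. H #> g) ` R0 = (\<lambda>g. H #> g) ` carrier G"
    by (metis finite_subset_image[OF H(2)[unfolded finite_rcosets_iff] subset_refl])
  define R where "R = insert \<one> R0"
  have R: "finite R" "R \<subseteq> carrier G" "\<one> \<in> R" using R0 by (auto simp: R_def)
  have rep: "\<exists>b\<in>R. g \<otimes> inv b \<in> H" if "g \<in> carrier G" for g
  proof -
    have "H #> g \<in> (\<lambda>g. H #> g) ` R0" unfolding R0(3) using that by blast
    then obtain b where "b \<in> R0" "H #> g = H #> b" by blast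
    then show ?thesis using rcos_eq_iff[OF H(1), of g b] R0(2) that by (auto simp: R_def)
  qed
  \<comment> \<open>\<open>R\<close> may contain several elements of one coset. Allowing
    \<open>\<one>\<close> as a middle letter puts \<open>R \<inter> H\<close> into \<open>U\<close>,
    which is needed at the end to absorb the representative of an element of
    \<open>H\<close>.\<close>
  define U where "U = H \<inter> (\<lambda>(a, s, b). a \<otimes> s \<otimes> inv b) ` (R \<times> (insert \<one> (S \<union> m_inv G ` S)) \<times> R)"
  have U: "finite U" "U \<subseteq> H" "U \<subseteq> carrier G"
    using R assms(1) subgroup.subset[OF H(1)] by (auto simp: U_def)
  define K where "K = generate G U"
  have K: "subgroup K G" "K \<subseteq> H" "K \<subseteq> carrier G"
    unfolding K_def using generate_is_subgroup[OF U(3)] generate_subgroup_incl[OF U(2) H(1)] U(3)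
    by (auto dest: subgroup.subset)
  have step: "\<exists>k'\<in>K. \<exists>b\<in>R. k \<otimes> a \<otimes> s = k' \<otimes> b"
    if sU: "s \<in> insert \<one> (S \<union> m_inv G ` S)" and k: "k \<in> K" and a: "a \<in> R" for k a s
  proof -
    have s: "s \<in> carrier G" using that assms(2) by auto
    obtain b where b: "b \<in> R" "a \<otimes> s \<otimes> inv b \<in> H" using rep[of "a \<otimes> s"] a R(2) s by blast
    have "a \<otimes> s \<otimes> inv b \<in> U" unfolding U_def using b sU a by force
    then have "a \<otimes> s \<otimes> inv b \<in> K" unfolding K_def by (rule generate.incl)
    then have "k \<otimes> (a \<otimes> s \<otimes> inv b) \<in> K" using subgroup.m_closed[OF K(1)] k by blast
    moreover have "k \<otimes> a \<otimes> s = k \<otimes> (a \<otimes> s \<otimes> inv b) \<otimes> b"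
      using k a b R K(3) s by (simp add: m_assoc subset_iff)
    ultimately show ?thesis using b by blast
  qed
  have all: "\<forall>k\<in>K. \<forall>a\<in>R. \<exists>k'\<in>K. \<exists>b\<in>R. k \<otimes> a \<otimes> g = k' \<otimes> b" if "g \<in> generate G S" for g
    using that
  proof (induction rule: generate.induct)
    case (eng g1 g2)
    show ?case
    proof (intro ballI)
      fix k a assume ka: "k \<in> K" "a \<in> R"
      obtain k' b where k': "k' \<in> K" "b \<in> R" "k \<otimes> a \<otimes> g1 = k' \<otimes> b" using eng ka by blast
      obtain k'' c where "k'' \<in> K" "c \<in> R" "k' \<otimes> b \<otimes> g2 = k'' \<otimes> c" using eng k' by blast
      moreover have "g1 \<in> carrier G" "g2 \<in> carrier G" using eng assms by auto
      then have "k \<otimes> a \<otimes> (g1 \<otimes> g2) = k \<otimes> a \<otimes> g1 \<otimes> g2"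
        using ka K(3) R(2) by (simp add: m_assoc subset_iff)
      ultimately show "\<exists>k'\<in>K. \<exists>b\<in>R. k \<otimes> a \<otimes> (g1 \<otimes> g2) = k' \<otimes> b" using k'(3) by auto
    qed
  qed (use step in blast)+
  have "H \<subseteq> K"
  proof
    fix h assume h: "h \<in> H"
    then have hG: "h \<in> carrier G" using subgroup.subset[OF H(1)] by auto
    obtain k b where kb: "k \<in> K" "b \<in> R" "\<one> \<otimes> \<one> \<otimes> h = k \<otimes> b"
      using all[of h] hG assms(3) R(3) subgroup.one_closed[OF K(1)] by blast
    have kG: "k \<in> carrier G" "b \<in> carrier G" using kb K R by auto
    have "inv k \<otimes> h \<in> H" using kb h K(2) by (meson H(1) subgroup.m_closed subgroup.m_inv_closed subsetD)
    then have "b \<in> H" using kb kG hG by (simp add: m_assoc[symmetric])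
    then have "b \<in> U" unfolding U_def using kb(2) R(3) kG by (force intro!: image_eqI[of _ _ "(b, \<one>, \<one>)"])
    then have "b \<in> K" unfolding K_def by (rule generate.incl)
    then show "h \<in> K" using kb hG subgroup.m_closed[OF K(1)] by auto
  qed
  then show ?thesis using U K K_def by blast
qed

text \<open>For normal \<open>N\<close> this is virtual nilpotency of \<open>G Mod N\<close>,
  phrased with subgroups of \<open>G\<close> so that different \<open>N\<close> are compared inside
  one group.\<close>

definition virtually_nilpotent_mod :: "('a, 'b) monoid_scheme \<Rightarrow> 'a set \<Rightarrow> bool" where
  "virtually_nilpotent_mod G N \<longleftrightarrow>
    (\<exists>H n. subgroup H G \<and> finite (rcosets\<^bsub>G\<^esub> H) \<and> lower_central (G\<lparr>carrier := H\<rparr>) n \<subseteq> N)"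

lemma (in group) virtually_nilpotent_iff_mod_one:
  "virtually_nilpotent G \<longleftrightarrow> virtually_nilpotent_mod G {\<one>}"
proof -
  have "lower_central (G\<lparr>carrier := H\<rparr>) n = {\<one>} \<longleftrightarrow> lower_central (G\<lparr>carrier := H\<rparr>) n \<subseteq> {\<one>}"
    if "subgroup H G" for H n
    using group.one_in_lower_central[OF subgroup_imp_group[OF that], of n] by auto
  then have "(subgroup H G \<and> finite (rcosets H) \<and> nilpotent_group (G\<lparr>carrier := H\<rparr>)) \<longleftrightarrow>
      (\<exists>n. subgroup H G \<and> finite (rcosets H) \<and> lower_central (G\<lparr>carrier := H\<rparr>) n \<subseteq> {\<one>})" for H
    unfolding nilpotent_group_def using subgroup_imp_group[of H] by auto
  then show ?thesis
    unfolding virtually_nilpotent_def virtually_nilpotent_mod_def by simp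
qed

text \<open>With \<open>M\<close> the normal closure of \<open>N\<close> and \<open>z\<close>, the centralizer of \<open>M\<close> modulo \<open>N\<close> is the kernel
  of the action of \<open>G\<close> on the finite conjugacy class of \<open>N #> z\<close>, hence of finite index.\<close>
lemma (in group) virtually_nilpotent_mod_fc_extension:
  assumes N: "N \<lhd> G" and z: "z \<in> carrier G" "finite ((\<lambda>k. N #> (inv k \<otimes> z \<otimes> k)) ` carrier G)"
    and M: "M = generate G (N \<union> (\<lambda>k. inv k \<otimes> z \<otimes> k) ` carrier G)" "virtually_nilpotent_mod G M"
  shows "virtually_nilpotent_mod G N"
proof -
  interpret h: group_hom G "G Mod N" "\<lambda>x. N #> x" by (rule group_hom_Mod[OF N])
  interpret normal N G by fact
  let ?Q = "G Mod N"
  let ?A = "(\<lambda>k. inv k \<otimes> z \<otimes> k) ` carrier G"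
  define V where "V = (\<lambda>a. N #> a) ` ?A"
  have A: "?A \<subseteq> carrier G" using z by auto
  have MG: "M \<subseteq> carrier G" unfolding M(1) by (rule generate_incl) (use A subset in auto)
  have V: "finite V" "V \<subseteq> carrier ?Q"
    using z(2) A h.hom_closed by (auto simp: V_def image_image)
  define C where "C = {x \<in> carrier G. \<forall>m\<in>M. x \<otimes> m \<otimes> inv x \<otimes> inv m \<in> N}"
  have C: "subgroup C G" unfolding C_def by (rule centralizer_mod_is_subgroup[OF N MG])
  have CI: "x \<in> C" if x: "x \<in> carrier G" and comm: "\<And>v. v \<in> V \<Longrightarrow> (N #> x) \<otimes>\<^bsub>?Q\<^esub> v = v \<otimes>\<^bsub>?Q\<^esub> (N #> x)" for x
  proof -
    let ?D = "{m \<in> carrier G. \<forall>a\<in>{x}. m \<otimes> a \<otimes> inv m \<otimes> inv a \<in> N}"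
    have D: "subgroup ?D G" by (rule centralizer_mod_is_subgroup[OF N]) (use x in simp)
    have "N \<subseteq> ?D"
    proof
      fix n assume n: "n \<in> N"
      then have "n \<otimes> (x \<otimes> inv n \<otimes> inv x) \<in> N" using x by (intro m_closed inv_op_closed2) auto
      then show "n \<in> ?D" using n x by (simp add: m_assoc)
    qed
    moreover have "?A \<subseteq> ?D"
      using comm A x commutator_in_normal_iff[OF N] by (auto simp: V_def)
    ultimately have "M \<subseteq> ?D" unfolding M(1) by (intro generate_subgroup_incl[OF _ D]) auto
    then have "\<forall>m\<in>M. x \<otimes> m \<otimes> inv x \<otimes> inv m \<in> N"
      using centralizer_mod_sym[OF N x] by blast
    then show ?thesis using x by (simp add: C_def)
  qed
  have Vconj: "inv\<^bsub>?Q\<^esub> (N #> g) \<otimes>\<^bsub>?Q\<^esub> v \<otimes>\<^bsub>?Q\<^esub> (N #> g) \<in> V" if g: "g \<in> carrier G" and v: "v \<in> V" for g v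
  proof -
    obtain k where k: "k \<in> carrier G" "v = N #> (inv k \<otimes> z \<otimes> k)" using v by (auto simp: V_def)
    have "inv\<^bsub>?Q\<^esub> (N #> g) \<otimes>\<^bsub>?Q\<^esub> v \<otimes>\<^bsub>?Q\<^esub> (N #> g) = N #> (inv g \<otimes> (inv k \<otimes> z \<otimes> k) \<otimes> g)"
      using g k z h.hom_inv[OF g] h.hom_mult by simp
    also have "\<dots> = N #> (inv (k \<otimes> g) \<otimes> z \<otimes> (k \<otimes> g))"
      using g k z by (simp add: inv_mult_group m_assoc)
    finally show ?thesis using g k unfolding V_def by blast
  qed
  have finC: "finite (rcosets C)" unfolding finite_rcosets_iff
  proof (rule finite_image_factor)
    let ?act = "\<lambda>g. restrict (\<lambda>v. inv\<^bsub>?Q\<^esub> (N #> g) \<otimes>\<^bsub>?Q\<^esub> v \<otimes>\<^bsub>?Q\<^esub> (N #> g)) V"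
    have "?act ` carrier G \<subseteq> V \<rightarrow>\<^sub>E V" using Vconj by auto
    moreover have "finite (V \<rightarrow>\<^sub>E V)" using V(1) by (simp add: finite_PiE)
    ultimately show "finite (?act ` carrier G)" by (rule finite_subset)
    fix x y assume x: "x \<in> carrier G" and y: "y \<in> carrier G" and eq: "?act x = ?act y"
    have "x \<otimes> inv y \<in> C"
    proof (rule CI)
      fix v assume v: "v \<in> V"
      have c: "v \<in> carrier ?Q" "N #> x \<in> carrier ?Q" "N #> y \<in> carrier ?Q"
        using v V x y h.hom_closed by auto
      have "inv\<^bsub>?Q\<^esub> (N #> x) \<otimes>\<^bsub>?Q\<^esub> v \<otimes>\<^bsub>?Q\<^esub> (N #> x) = inv\<^bsub>?Q\<^esub> (N #> y) \<otimes>\<^bsub>?Q\<^esub> v \<otimes>\<^bsub>?Q\<^esub> (N #> y)"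
        using fun_cong[OF eq, of v] v by simp
      then have "(N #> x) \<otimes>\<^bsub>?Q\<^esub> (inv\<^bsub>?Q\<^esub> (N #> x) \<otimes>\<^bsub>?Q\<^esub> v \<otimes>\<^bsub>?Q\<^esub> (N #> x)) \<otimes>\<^bsub>?Q\<^esub> inv\<^bsub>?Q\<^esub> (N #> y) =
         (N #> x) \<otimes>\<^bsub>?Q\<^esub> (inv\<^bsub>?Q\<^esub> (N #> y) \<otimes>\<^bsub>?Q\<^esub> v \<otimes>\<^bsub>?Q\<^esub> (N #> y)) \<otimes>\<^bsub>?Q\<^esub> inv\<^bsub>?Q\<^esub> (N #> y)" by simp
      then have "v \<otimes>\<^bsub>?Q\<^esub> ((N #> x) \<otimes>\<^bsub>?Q\<^esub> inv\<^bsub>?Q\<^esub> (N #> y)) = ((N #> x) \<otimes>\<^bsub>?Q\<^esub> inv\<^bsub>?Q\<^esub> (N #> y)) \<otimes>\<^bsub>?Q\<^esub> v"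
        using c h.H.inv_solve_left h.H.m_assoc h.H.r_inv h.H.r_one h.H.l_inv h.H.l_one h.H.inv_closed h.H.m_closed
        by (smt (verit, ccfv_threshold))
      then show "(N #> (x \<otimes> inv y)) \<otimes>\<^bsub>?Q\<^esub> v = v \<otimes>\<^bsub>?Q\<^esub> (N #> (x \<otimes> inv y))"
        using x y h.hom_inv[OF y] h.hom_mult by simp
    qed (use x y in simp)
    then show "C #> x = C #> y" using rcos_eq_iff[OF C x y] by simp
  qed
  obtain H n where H: "subgroup H G" "finite (rcosets H)" "lower_central (G\<lparr>carrier := H\<rparr>) n \<subseteq> M"
    using M(2) unfolding virtually_nilpotent_mod_def by auto
  have HC: "subgroup (H \<inter> C) G" by (rule subgroups_Inter_pair[OF H(1) C])
  have "lower_central (G\<lparr>carrier := H \<inter> C\<rparr>) n \<subseteq> M"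
    using lower_central_subgroup_mono[OF HC H(1), of n] H(3) by blast
  \<comment> \<open>\<open>n\<close> commutators lead into \<open>M\<close>, which \<open>C\<close>
    centralizes modulo \<open>N\<close>; one more lands in \<open>N\<close>.\<close>
  then have "lower_central (G\<lparr>carrier := H \<inter> C\<rparr>) (Suc n) \<subseteq> N"
    by (intro lower_central_subgroup_least[OF HC normal_imp_subgroup[OF N]]) (auto simp: C_def)
  then show ?thesis
    unfolding virtually_nilpotent_mod_def using HC finite_rcosets_Int[OF H(1) C H(2) finC] by blast
qed

lemma (in group) normal_Union_chain:
  assumes "\<C> \<noteq> {}" "subset.chain {N. N \<lhd> G} \<C>"
  shows "\<Union>\<C> \<lhd> G"
proof -
  have n: "N \<lhd> G" "subgroup N G" if "N \<in> \<C>" for N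
    using assms(2) that normal_imp_subgroup unfolding subset.chain_def by auto
  have "subgroup (\<Union>\<C>) G"
  proof (rule subgroupI)
    fix a b assume "a \<in> \<Union>\<C>" "b \<in> \<Union>\<C>"
    then obtain A B where AB: "A \<in> \<C>" "B \<in> \<C>" "a \<in> A" "b \<in> B" by auto
    then have "A \<subseteq> B \<or> B \<subseteq> A" using assms(2) unfolding subset_chain_def by blast
    then show "a \<otimes> b \<in> \<Union>\<C>"
    proof
      assume "A \<subseteq> B"
      then have "a \<otimes> b \<in> B" using AB subgroup.m_closed[OF n(2)[OF AB(2)]] by blast
      then show ?thesis using AB by blast
    next
      assume "B \<subseteq> A"
      then have "a \<otimes> b \<in> A" using AB subgroup.m_closed[OF n(2)[OF AB(1)]] by blast
      then show ?thesis using AB by blast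
    qed
  next
    obtain A where "A \<in> \<C>" using assms(1) by blast
    then show "\<Union>\<C> \<noteq> {}" using subgroup.one_closed[OF n(2)] by blast
  next
    show "\<Union>\<C> \<subseteq> carrier G" using subgroup.subset[OF n(2)] by blast
  next
    fix a assume "a \<in> \<Union>\<C>"
    then obtain A where "A \<in> \<C>" "a \<in> A" by auto
    then show "inv a \<in> \<Union>\<C>" using subgroup.m_inv_closed[OF n(2)] by blast
  qed
  then show ?thesis
  proof (rule normal_invI)
    fix x h assume x: "x \<in> carrier G" and "h \<in> \<Union>\<C>"
    then obtain A where "A \<in> \<C>" "h \<in> A" by auto
    then show "x \<otimes> h \<otimes> inv x \<in> \<Union>\<C>" using normal.inv_op_closed2[OF n(1) x] by blast
  qed
qed

text \<open>A normal subgroup maximal among those modulo which \<open>G\<close> is not virtually nilpotent would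
  contradict the extension lemma. Such a subgroup exists by Zorn's lemma, because over the finite
  generating set of a finite-index subgroup nilpotency of a given class amounts to finitely many relations.\<close>
lemma (in group) no_icc_quotient_imp_virtually_nilpotent:
  assumes "finitely_generated G" "\<not> has_icc_quotient G"
  shows "virtually_nilpotent G"
proof (rule ccontr)
  assume neg: "\<not> virtually_nilpotent G"
  obtain S where S: "finite S" "S \<subseteq> carrier G" "generate G S = carrier G"
    using assms(1) unfolding finitely_generated_def by auto
  define \<F> where "\<F> = {N. N \<lhd> G \<and> \<not> virtually_nilpotent_mod G N}"
  have "\<exists>N\<in>\<F>. \<forall>M\<in>\<F>. N \<subseteq> M \<longrightarrow> M = N"
  proof (rule subset_Zorn_nonempty)
    show "\<F> \<noteq> {}"
      using neg one_is_normal unfolding virtually_nilpotent_iff_mod_one \<F>_def by blast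
    fix \<C> assume \<C>: "\<C> \<noteq> {}" "subset.chain \<F> \<C>"
    have "subset.chain {N. N \<lhd> G} \<C>" using \<C>(2) unfolding subset.chain_def \<F>_def by auto
    then have U: "\<Union>\<C> \<lhd> G" using normal_Union_chain \<C>(1) by blast
    moreover have "\<not> virtually_nilpotent_mod G (\<Union>\<C>)"
    proof
      assume "virtually_nilpotent_mod G (\<Union>\<C>)"
      then obtain H n where H: "subgroup H G" "finite (rcosets H)" "lower_central (G\<lparr>carrier := H\<rparr>) n \<subseteq> \<Union>\<C>"
        unfolding virtually_nilpotent_mod_def by auto
      interpret K: group "G\<lparr>carrier := H\<rparr>" by (rule subgroup_imp_group[OF H(1)])
      obtain T where T: "finite T" "T \<subseteq> H" "generate G T = H"
        using schreier_finitely_generated[OF S H(1,2)] by auto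
      let ?L = "left_normed_commutators (G\<lparr>carrier := H\<rparr>) T n"
      have "?L \<subseteq> \<Union>\<C>" using K.left_normed_commutators_subset[of T n] T(2) H(3) by auto
      then obtain N where N: "N \<in> \<C>" "?L \<subseteq> N"
        using finite_subset_Union_chain[OF finite_left_normed_commutators[OF T(1)] _ \<C>] by blast
      then have NA: "N \<lhd> G" "\<not> virtually_nilpotent_mod G N"
        using \<C>(2) unfolding subset.chain_def \<F>_def by auto
      have "?L \<subseteq> H"
        using K.left_normed_commutators_subset[of T n] T(2) K.lower_central_subset[of n] by auto
      \<comment> \<open>\<open>N\<close> need not lie in \<open>H\<close>, so the relations are read
        modulo \<open>H \<inter> N\<close>, which is normal in \<open>H\<close>.\<close>
      then have "lower_central (G\<lparr>carrier := H\<rparr>) n \<subseteq> H \<inter> N"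
        using N(2) T generate_consistent[OF T(2) H(1)] normal_Int_subgroup[OF H(1) NA(1)]
        by (intro K.lower_central_subset_if_generators[of T]) (auto simp: Int_commute)
      then have "virtually_nilpotent_mod G N" using H unfolding virtually_nilpotent_mod_def by blast
      then show False using NA by simp
    qed
    ultimately show "\<Union>\<C> \<in> \<F>" by (simp add: \<F>_def)
  qed
  then obtain N where N: "N \<lhd> G" "\<not> virtually_nilpotent_mod G N"
    and max: "\<And>M. M \<lhd> G \<Longrightarrow> N \<subseteq> M \<Longrightarrow> M \<noteq> N \<Longrightarrow> virtually_nilpotent_mod G M"
    unfolding \<F>_def by blast
  interpret normal N G by fact
  have "finite (rcosets (carrier G))"
    unfolding finite_rcosets_iff
    by (rule finite_image_factor[of "\<lambda>_. ()"]) (auto simp: rcos_eq_iff[OF subgroup_self])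
  then have "virtually_nilpotent_mod G (carrier G)"
    unfolding virtually_nilpotent_mod_def using subgroup_self
    by (intro exI[of _ "carrier G"] exI[of _ 0]) auto
  then have "N \<noteq> carrier G" using N by auto
  then obtain z where z: "z \<in> carrier G - N" "finite ((\<lambda>k. N #> (inv k \<otimes> z \<otimes> k)) ` carrier G)"
    using assms(2) N icc_Mod_iff[OF N(1)] unfolding has_icc_quotient_def by blast
  define M where "M = generate G (N \<union> (\<lambda>k. inv k \<otimes> z \<otimes> k) ` carrier G)"
  have "M \<lhd> G" unfolding M_def
  proof (rule normal_generateI)
    fix x g assume x: "x \<in> N \<union> (\<lambda>k. inv k \<otimes> z \<otimes> k) ` carrier G" and g: "g \<in> carrier G"
    show "g \<otimes> x \<otimes> inv g \<in> N \<union> (\<lambda>k. inv k \<otimes> z \<otimes> k) ` carrier G"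
    proof (cases "x \<in> N")
      case True
      then show ?thesis using inv_op_closed2 g by blast
    next
      case False
      then obtain k where k: "k \<in> carrier G" "x = inv k \<otimes> z \<otimes> k" using x by auto
      then have "g \<otimes> x \<otimes> inv g = inv (k \<otimes> inv g) \<otimes> z \<otimes> (k \<otimes> inv g)"
        using g z by (simp add: inv_mult_group m_assoc)
      then show ?thesis using g k by blast
    qed
  qed (use subset z in auto)
  moreover have "N \<subseteq> M" unfolding M_def by (auto intro: generate.incl)
  moreover have "z \<in> M"
    unfolding M_def 
  proof (rule generate.incl)
    have "z = inv \<one> \<otimes> z \<otimes> \<one>" using z by simp
    then show "z \<in> N \<union> (\<lambda>k. inv k \<otimes> z \<otimes> k) ` carrier G"
      using monoid.one_closed[OF is_monoid] by blast
  qed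
  ultimately have "virtually_nilpotent_mod G M" using max z by blast
  then show False
    using virtually_nilpotent_mod_fc_extension[OF N(1) _ z(2) M_def] z N(2) by auto
qed

text \<open>An element outside \<open>N\<close> that commutes with \<open>H\<close> modulo
  \<open>N\<close> has a finite class modulo \<open>N\<close>, since its conjugates depend only on
  the coset of \<open>H\<close>. Such an element exists in the last lower central term of
  \<open>H\<close> not contained in \<open>N\<close>; if \<open>H \<subseteq> N\<close>, any element
  outside \<open>N\<close> will do.\<close>

lemma (in group) virtually_nilpotent_imp_no_icc_quotient:
  assumes "virtually_nilpotent G"
  shows "\<not> has_icc_quotient G"
proof
  assume "has_icc_quotient G"
  then obtain N where N: "N \<lhd> G" "N \<noteq> carrier G"
    and inf: "\<And>z. z \<in> carrier G - N \<Longrightarrow> infinite ((\<lambda>k. N #> (inv k \<otimes> z \<otimes> k)) ` carrier G)"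
    unfolding has_icc_quotient_def using icc_Mod_iff by blast
  interpret h: group_hom G "G Mod N" "\<lambda>x. N #> x" by (rule group_hom_Mod[OF N(1)])
  interpret normal N G by fact
  obtain H n where H: "subgroup H G" "finite (rcosets H)" "lower_central (G\<lparr>carrier := H\<rparr>) n \<subseteq> {\<one>}"
    using assms unfolding virtually_nilpotent_iff_mod_one virtually_nilpotent_mod_def by auto
  define P where "P m \<longleftrightarrow> lower_central (G\<lparr>carrier := H\<rparr>) m \<subseteq> N" for m
  have HG: "H \<subseteq> carrier G" using subgroup.subset[OF H(1)] .
  have finite_class: "finite ((\<lambda>k. N #> (inv k \<otimes> z \<otimes> k)) ` carrier G)"
    if z: "z \<in> carrier G" and c: "\<And>x. x \<in> H \<Longrightarrow> x \<otimes> z \<otimes> inv x \<otimes> inv z \<in> N" for z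
  proof (rule finite_image_factor[OF H(2)[unfolded finite_rcosets_iff]])
    fix x y assume x: "x \<in> carrier G" and y: "y \<in> carrier G" and "H #> x = H #> y"
    then have "y \<otimes> inv x \<in> H" using rcos_eq_iff[OF H(1) y x] by simp
    then have "N #> (y \<otimes> inv x \<otimes> z) = N #> (z \<otimes> (y \<otimes> inv x))"
      using c[of "y \<otimes> inv x"] commutator_in_normal_iff[OF N(1), of "y \<otimes> inv x" z] x y z by simp
    then have "(N #> inv y) \<otimes>\<^bsub>G Mod N\<^esub> (N #> (y \<otimes> inv x \<otimes> z)) \<otimes>\<^bsub>G Mod N\<^esub> (N #> x) =
       (N #> inv y) \<otimes>\<^bsub>G Mod N\<^esub> (N #> (z \<otimes> (y \<otimes> inv x))) \<otimes>\<^bsub>G Mod N\<^esub> (N #> x)" by simp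
    then have "N #> (inv y \<otimes> (y \<otimes> inv x \<otimes> z) \<otimes> x) = N #> (inv y \<otimes> (z \<otimes> (y \<otimes> inv x)) \<otimes> x)"
      using x y z by (simp add: rcos_sum)
    moreover have "inv y \<otimes> (y \<otimes> inv x \<otimes> z) \<otimes> x = inv x \<otimes> z \<otimes> x"
      using x y z by (simp add: m_assoc[symmetric])
    moreover have "inv y \<otimes> (z \<otimes> (y \<otimes> inv x)) \<otimes> x = inv y \<otimes> z \<otimes> y"
      using x y z by (simp add: m_assoc)
    ultimately show "N #> (inv x \<otimes> z \<otimes> x) = N #> (inv y \<otimes> z \<otimes> y)" by simp
  qed
  have "P n" using H(3) unfolding P_def by auto
  show False
  proof (cases "P 0")
    case True
    then have HN: "H \<subseteq> N" by (simp add: P_def)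
    obtain z where z: "z \<in> carrier G - N" using N(2) subset by auto
    have "x \<otimes> z \<otimes> inv x \<otimes> inv z \<in> N" if "x \<in> H" for x
    proof -
      have xN: "x \<in> N" "inv x \<in> N" using that HN by auto
      have "x \<otimes> (z \<otimes> inv x \<otimes> inv z) \<in> N"
        using xN z by (intro m_closed inv_op_closed2) auto
      then show ?thesis using xN z by (simp add: m_assoc)
    qed
    then show False using finite_class[of z] inf[of z] z by auto
  next
    case False
    define m where "m = (LEAST m. P m)"
    have "P m" "m \<noteq> 0" using LeastI[of P n] \<open>P n\<close> False unfolding m_def by metis+
    then obtain l where l: "m = Suc l" "\<not> P l"
      using not_less_Least[of _ P] unfolding m_def by (metis lessI not0_implies_Suc)
    obtain z where z: "z \<in> lower_central (G\<lparr>carrier := H\<rparr>) l" "z \<notin> N" using l unfolding P_def by auto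
    have zH: "z \<in> carrier G" using z HG lower_central_subgroup_subset[OF H(1)] by blast
    have "x \<otimes> z \<otimes> inv x \<otimes> inv z \<in> N" if "x \<in> H" for x
    proof -
      have "x \<otimes> z \<otimes> inv x \<otimes> inv z \<in> lower_central (G\<lparr>carrier := H\<rparr>) (Suc l)"
        unfolding lower_central_subgroup_Suc[OF H(1)] by (rule generate.incl) (use that z in blast)
      then show ?thesis using \<open>P m\<close> l unfolding P_def by blast
    qed
    then show False using finite_class[of z] inf[of z] z zH by auto
  qed
qed

section \<open>Switching elements\<close>

text \<open>B. H. Neumann's covering argument: the sets \<open>{g. g\<^sup>-\<^sup>1 t g = s}\<close> are cosets of centralizers, which have
  infinite index. If those for \<open>t\<^sub>0\<close> were needed in a cover, then one missing coset of the centralizer of \<open>t\<^sub>0\<close>,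
  and hence by translation each of its cosets, is already covered by the remaining sets.\<close>
lemma (in group) ex_conjugator_avoiding:
  assumes "finite T" "T \<subseteq> carrier G" "\<And>t. t \<in> T \<Longrightarrow> infinite (conj_class G t)" "finite S"
  shows "\<exists>g\<in>carrier G. \<forall>t\<in>T. inv g \<otimes> t \<otimes> g \<notin> S"
  using assms
proof (induction T arbitrary: S rule: finite_induct)
  case empty
  then show ?case using one_closed by blast
next
  case (insert t0 T)
  have t0: "t0 \<in> carrier G" and inf: "infinite (conj_class G t0)" using insert.prems by auto
  have "\<not> conj_class G t0 \<subseteq> S" using inf insert.prems(3) finite_subset by blast
  then obtain k where k: "k \<in> carrier G" "inv k \<otimes> t0 \<otimes> k \<notin> S" unfolding conj_class_def by blast
  define a where "a = inv k \<otimes> t0 \<otimes> k"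
  have aG: "a \<in> carrier G" using k t0 by (simp add: a_def)
  have "\<forall>s\<in>conj_class G t0. \<exists>b\<in>carrier G. b \<otimes> s \<otimes> inv b = a"
  proof
    fix s assume "s \<in> conj_class G t0"
    then obtain l where l: "l \<in> carrier G" "s = inv l \<otimes> t0 \<otimes> l" unfolding conj_class_def by blast
    have "(inv k \<otimes> l) \<otimes> s \<otimes> inv (inv k \<otimes> l) = inv k \<otimes> (l \<otimes> inv l) \<otimes> t0 \<otimes> (l \<otimes> inv l) \<otimes> k"
      unfolding l(2) using k(1) l(1) t0 by (simp only: inv_mult_group inv_inv inv_closed m_closed m_assoc)
    also have "\<dots> = a" using k l t0 by (simp add: a_def)
    finally show "\<exists>b\<in>carrier G. b \<otimes> s \<otimes> inv b = a" using k l by blast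
  qed
  then obtain b where b: "\<And>s. s \<in> conj_class G t0 \<Longrightarrow> b s \<in> carrier G"
    "\<And>s. s \<in> conj_class G t0 \<Longrightarrow> b s \<otimes> s \<otimes> inv (b s) = a" by metis
  \<comment> \<open>If \<open>g\<close> fails at \<open>t0\<close> by hitting \<open>s\<close>, it
    is corrected to \<open>g \<otimes> inv (b s)\<close>, which sends \<open>t0\<close> to
    \<open>a\<close>, outside \<open>S\<close>. The second part of \<open>S'\<close> ensures that
    the elements of \<open>T\<close> still avoid \<open>S\<close> after this correction.\<close>
  define S' where "S' = S \<union> (\<lambda>(s, y). inv (b s) \<otimes> y \<otimes> b s) ` (S \<times> S)"
  have "finite S'" using insert.prems(3) by (simp add: S'_def)
  then obtain g where g: "g \<in> carrier G" "\<And>t. t \<in> T \<Longrightarrow> inv g \<otimes> t \<otimes> g \<notin> S'"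
    using insert.IH[of S'] insert.prems(1,2) by blast
  show ?case
  proof (cases "inv g \<otimes> t0 \<otimes> g \<in> S")
    case False
    then show ?thesis using g unfolding S'_def by blast
  next
    case True
    define s where "s = inv g \<otimes> t0 \<otimes> g"
    have s: "s \<in> conj_class G t0" "s \<in> S" using g(1) True unfolding conj_class_def s_def by blast+
    have bG: "b s \<in> carrier G" using b(1) s by blast
    let ?g = "g \<otimes> inv (b s)"
    have conj: "inv ?g \<otimes> t \<otimes> ?g = b s \<otimes> (inv g \<otimes> t \<otimes> g) \<otimes> inv (b s)" if "t \<in> carrier G" for t
      using that g bG by (simp add: inv_mult_group m_assoc)
    have "inv ?g \<otimes> t0 \<otimes> ?g \<notin> S"
      using conj[OF t0] b(2)[OF s(1)] k(2) unfolding s_def a_def by simp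
    moreover have "inv ?g \<otimes> t \<otimes> ?g \<notin> S" if t: "t \<in> T" for t
    proof
      assume *: "inv ?g \<otimes> t \<otimes> ?g \<in> S"
      have tG: "t \<in> carrier G" using t insert.prems by auto
      have "inv (b s) \<otimes> (inv ?g \<otimes> t \<otimes> ?g) \<otimes> b s = (inv (b s) \<otimes> b s) \<otimes> (inv g \<otimes> t \<otimes> g) \<otimes> (inv (b s) \<otimes> b s)"
        unfolding conj[OF tG] using tG g(1) bG by (simp only: m_assoc inv_closed m_closed)
      also have "\<dots> = inv g \<otimes> t \<otimes> g" using tG g(1) bG by simp
      finally have "inv g \<otimes> t \<otimes> g \<in> (\<lambda>(s, y). inv (b s) \<otimes> y \<otimes> b s) ` (S \<times> S)"
        using * s(2) by force
      then show False using g(2)[OF t] unfolding S'_def by blast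
    qed
    ultimately show ?thesis using g(1) bG by (intro bexI[of _ ?g]) auto
  qed
qed

text \<open>The two clauses exclude coincidences between words containing \<open>g\<close> or its
  inverse once: the first handles equal exponents, the second opposite ones.\<close>

definition super_switching :: "('a, 'b) monoid_scheme \<Rightarrow> 'a set \<Rightarrow> 'a \<Rightarrow> bool" where
  "super_switching G W g \<longleftrightarrow> (\<forall>x\<in>W. (x \<noteq> \<one>\<^bsub>G\<^esub> \<longrightarrow> inv\<^bsub>G\<^esub> g \<otimes>\<^bsub>G\<^esub> x \<otimes>\<^bsub>G\<^esub> g \<notin> W) \<and> g \<otimes>\<^bsub>G\<^esub> x \<otimes>\<^bsub>G\<^esub> g \<notin> W)"

text \<open>The condition \<open>g x g \<noteq> y\<close> is not about cosets. But if both \<open>g\<close> and \<open>g t\<close> solve \<open>g x g = y\<close>, then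
  \<open>x g\<close> conjugates \<open>t\<close> to its inverse, which does define a coset of a centralizer. So for \<open>u\<close> outside finitely many
  such cosets, two of the elements \<open>u d\<close>, \<open>d \<in> D\<close>, never solve the same equation, and the pigeonhole principle
  applies as soon as \<open>D\<close> is larger than the number of equations.\<close>
lemma (in group) icc_ex_super_switching:
  assumes "icc G" "finite W" "W \<subseteq> carrier G"
  shows "\<exists>g\<in>carrier G. super_switching G W g"
proof -
  have inf: "infinite (conj_class G x)" if "x \<in> carrier G" "x \<noteq> \<one>" for x
    using assms(1) that unfolding icc_def by blast
  obtain x0 where x0: "x0 \<in> carrier G" "x0 \<noteq> \<one>" using assms(1) one_closed unfolding icc_def by blast
  have "conj_class G x0 \<subseteq> carrier G" using x0(1) unfolding conj_class_def by auto
  then have "infinite (carrier G)" using inf[OF x0] finite_subset by blast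
  then obtain D where D: "finite D" "D \<subseteq> carrier G" "card D = Suc (card (W \<times> W))"
    using infinite_arbitrarily_large by metis
  define E where "E = {(d, d') \<in> D \<times> D. d \<noteq> d'}"
  have "finite E" using D(1) by (auto intro: finite_subset[of _ "D \<times> D"] simp: E_def)
  \<comment> \<open>The first parts of \<open>T\<close> and \<open>S\<close> encode the conjugation
    clause for all candidates \<open>u \<otimes> d\<close> at once; the second parts encode that two
    candidates solve the same equation \<open>g x g = y\<close>.\<close>
  define T where "T = (W - {\<one>}) \<union> (\<lambda>(x, d, d'). inv x \<otimes> (inv d \<otimes> d') \<otimes> x) ` (W \<times> E)"
  define S where "S = (\<lambda>(d, y). d \<otimes> y \<otimes> inv d) ` (D \<times> W) \<union> (\<lambda>(d, d'). d \<otimes> inv (inv d \<otimes> d') \<otimes> inv d) ` E"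
  have T: "finite T" "T \<subseteq> carrier G"
    using assms(2,3) \<open>finite E\<close> D(2) by (auto simp: T_def E_def subset_iff)
  have S: "finite S" using assms(2) D(1) \<open>finite E\<close> by (simp add: S_def)
  have nontriv: "t \<noteq> \<one>" if t: "t \<in> T" for t
  proof (cases "t \<in> W - {\<one>}")
    case False
    then obtain x d d' where *: "x \<in> W" "d \<in> D" "d' \<in> D" "d \<noteq> d'" "t = inv x \<otimes> (inv d \<otimes> d') \<otimes> x"
      using t unfolding T_def E_def by auto
    then have c: "x \<in> carrier G" "d \<in> carrier G" "d' \<in> carrier G" using assms(3) D(2) by auto
    show ?thesis
    proof
      assume "t = \<one>"
      then have "x \<otimes> (inv x \<otimes> (inv d \<otimes> d') \<otimes> x) \<otimes> inv x = x \<otimes> \<one> \<otimes> inv x" using *(5) by simp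
      then have "inv d \<otimes> d' = \<one>" using c by (simp add: m_assoc[symmetric]) (simp add: m_assoc)
      then have "d \<otimes> (inv d \<otimes> d') = d" using c by simp
      then show False using c *(4) by (simp add: m_assoc[symmetric])
    qed
  qed auto
  have Tinf: "infinite (conj_class G t)" if "t \<in> T" for t using nontriv[OF that] that T(2) inf by blast
  obtain u where u: "u \<in> carrier G" "\<And>t. t \<in> T \<Longrightarrow> inv u \<otimes> t \<otimes> u \<notin> S"
    using ex_conjugator_avoiding[OF T Tinf S] by blast
  have sw: "inv (u \<otimes> d) \<otimes> x \<otimes> (u \<otimes> d) \<notin> W" if d: "d \<in> D" and x: "x \<in> W" "x \<noteq> \<one>" for d x
  proof
    assume *: "inv (u \<otimes> d) \<otimes> x \<otimes> (u \<otimes> d) \<in> W"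
    have c: "x \<in> carrier G" "d \<in> carrier G" using x d assms(3) D(2) by auto
    have "d \<otimes> (inv (u \<otimes> d) \<otimes> x \<otimes> (u \<otimes> d)) \<otimes> inv d = (d \<otimes> inv d) \<otimes> (inv u \<otimes> x \<otimes> u) \<otimes> (d \<otimes> inv d)"
      using c u(1) by (simp only: inv_mult_group m_assoc inv_closed m_closed)
    also have "\<dots> = inv u \<otimes> x \<otimes> u" using c u(1) by simp
    finally have "inv u \<otimes> x \<otimes> u \<in> S" using * d unfolding S_def by force
    moreover have "x \<in> T" using x by (simp add: T_def)
    ultimately show False using u(2) by blast
  qed
  have "\<exists>d\<in>D. \<forall>x\<in>W. (u \<otimes> d) \<otimes> x \<otimes> (u \<otimes> d) \<notin> W"
  proof (rule ccontr)
    assume "\<not> ?thesis"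
    then obtain f where f: "\<And>d. d \<in> D \<Longrightarrow> f d \<in> W" "\<And>d. d \<in> D \<Longrightarrow> (u \<otimes> d) \<otimes> f d \<otimes> (u \<otimes> d) \<in> W" by metis
    let ?p = "\<lambda>d. (f d, (u \<otimes> d) \<otimes> f d \<otimes> (u \<otimes> d))"
    have "\<not> inj_on ?p D"
    proof
      assume "inj_on ?p D"
      then have "card D \<le> card (W \<times> W)"
        by (rule card_inj_on_le) (use f assms(2) in auto)
      then show False using D(3) by simp
    qed
    then obtain d d' where *: "d \<in> D" "d' \<in> D" "d \<noteq> d'" "f d = f d'"
      and eq: "(u \<otimes> d) \<otimes> f d \<otimes> (u \<otimes> d) = (u \<otimes> d') \<otimes> f d \<otimes> (u \<otimes> d')" unfolding inj_on_def by auto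
    define x where "x = f d"
    define t where "t = inv d \<otimes> d'"
    define g where "g = u \<otimes> d"
    have "x \<in> carrier G" "d \<in> carrier G" "d' \<in> carrier G"
      using *(1,2) f(1) assms(3) D(2) unfolding x_def by blast+
    then have c: "x \<in> carrier G" "d \<in> carrier G" "d' \<in> carrier G" "t \<in> carrier G" "g \<in> carrier G"
      using u(1) by (simp_all add: t_def g_def)
    have d': "u \<otimes> d' = g \<otimes> t" using c u(1) by (simp add: g_def t_def m_assoc[symmetric]) (simp add: m_assoc)
    have "g \<otimes> (x \<otimes> g) = g \<otimes> x \<otimes> g" using c by (simp only: m_assoc)
    also have "\<dots> = (g \<otimes> t) \<otimes> x \<otimes> (g \<otimes> t)" using eq unfolding d' x_def g_def .
    also have "\<dots> = g \<otimes> (t \<otimes> x \<otimes> g \<otimes> t)" using c by (simp only: m_assoc m_closed)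
    finally have "g \<otimes> (x \<otimes> g) = g \<otimes> (t \<otimes> x \<otimes> g \<otimes> t)" .
    then have "x \<otimes> g = t \<otimes> x \<otimes> g \<otimes> t" using c by (metis l_cancel m_closed)
    note xg = this
    have "inv t = inv (x \<otimes> g) \<otimes> (x \<otimes> g) \<otimes> inv t" using c by simp
    also have "\<dots> = inv (x \<otimes> g) \<otimes> (t \<otimes> x \<otimes> g \<otimes> t) \<otimes> inv t"
      by (rule arg_cong[OF xg, of "\<lambda>y. inv (x \<otimes> g) \<otimes> y \<otimes> inv t"])
    also have "\<dots> = inv (x \<otimes> g) \<otimes> t \<otimes> x \<otimes> g \<otimes> (t \<otimes> inv t)"
      using c by (simp only: m_assoc inv_closed m_closed)
    also have "\<dots> = inv g \<otimes> inv x \<otimes> t \<otimes> x \<otimes> g" using c by (simp add: inv_mult_group)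
    finally have "inv t = inv g \<otimes> inv x \<otimes> t \<otimes> x \<otimes> g" .
    then have "d \<otimes> inv t \<otimes> inv d = (d \<otimes> inv d) \<otimes> (inv u \<otimes> (inv x \<otimes> t \<otimes> x) \<otimes> u) \<otimes> (d \<otimes> inv d)"
      unfolding g_def using c u(1) by (simp only: m_assoc inv_mult_group inv_closed m_closed)
    then have "d \<otimes> inv t \<otimes> inv d = inv u \<otimes> (inv x \<otimes> t \<otimes> x) \<otimes> u" using c u(1) by simp
    moreover have "inv x \<otimes> t \<otimes> x \<in> T" unfolding T_def E_def t_def x_def using * f(1) by force
    moreover have "d \<otimes> inv t \<otimes> inv d \<in> S" unfolding S_def E_def t_def using * by force
    ultimately show False using u(2) by metis
  qed
  then obtain d where d: "d \<in> D" "\<And>x. x \<in> W \<Longrightarrow> (u \<otimes> d) \<otimes> x \<otimes> (u \<otimes> d) \<notin> W" by blast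
  then have "super_switching G W (u \<otimes> d)" unfolding super_switching_def using sw by blast
  then show ?thesis using d(1) D(2) u(1) by blast
qed

section \<open>Words over growing alphabets\<close>

primrec words :: "('a, 'b) monoid_scheme \<Rightarrow> 'a set \<Rightarrow> nat \<Rightarrow> 'a set" where
  "words G A 0 = {\<one>\<^bsub>G\<^esub>}"
| "words G A (Suc n) = words G A n \<union> (\<lambda>(x, y). x \<otimes>\<^bsub>G\<^esub> y) ` (words G A n \<times> A)"

lemma finite_words: "finite A \<Longrightarrow> finite (words G A n)"
  by (induction n) auto

lemma one_in_words: "\<one>\<^bsub>G\<^esub> \<in> words G A n"
  by (induction n) auto

lemma words_mono:
  assumes "A \<subseteq> B" "m \<le> n"
  shows "words G A m \<subseteq> words G B n"
proof -
  have "words G A m \<subseteq> words G B m"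
  proof (induction m)
    case (Suc m)
    then show ?case unfolding words.simps using assms(1) by (intro Un_mono image_mono Sigma_mono)
  qed simp
  moreover have "words G B m \<subseteq> words G B n" using assms(2) by (rule lift_Suc_mono_le[rotated]) auto
  ultimately show ?thesis by blast
qed

lemma words_le: "x \<in> words G A m \<Longrightarrow> m \<le> n \<Longrightarrow> x \<in> words G A n"
  by (rule subsetD[OF words_mono[OF subset_refl]])

lemma words_snoc: "x \<in> words G A n \<Longrightarrow> y \<in> A \<Longrightarrow> x \<otimes>\<^bsub>G\<^esub> y \<in> words G A (Suc n)"
  by auto

lemma (in group) words_closed:
  assumes "A \<subseteq> carrier G"
  shows "words G A n \<subseteq> carrier G"
  using assms by (induction n) auto

lemma (in group) words_mult:
  assumes "A \<subseteq> carrier G" "x \<in> words G A m" "y \<in> words G A n"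
  shows "x \<otimes> y \<in> words G A (m + n)"
  using assms(3)
proof (induction n arbitrary: y)
  case 0
  moreover have "x \<in> carrier G" using assms(2) words_closed[OF assms(1)] by blast
  ultimately show ?case using assms(2) by simp
next
  case (Suc n)
  show ?case
  proof (cases "y \<in> words G A n")
    case True
    then show ?thesis using Suc.IH by simp
  next
    case False
    then obtain v a where va: "v \<in> words G A n" "a \<in> A" "y = v \<otimes> a" using Suc.prems by auto
    then have "x \<otimes> y = (x \<otimes> v) \<otimes> a"
      using assms(1,2) words_closed[OF assms(1)] by (simp add: m_assoc subset_iff)
    then show ?thesis using words_snoc[OF Suc.IH[OF va(1)] va(2)] by simp
  qed
qed

lemma (in group) words_inv:
  assumes "A \<subseteq> carrier G" "m_inv G ` A \<subseteq> A" "x \<in> words G A n"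
  shows "inv x \<in> words G A n"
  using assms(3)
proof (induction n arbitrary: x)
  case (Suc n)
  show ?case
  proof (cases "x \<in> words G A n")
    case True
    then show ?thesis using Suc.IH by simp
  next
    case False
    then obtain v a where va: "v \<in> words G A n" "a \<in> A" "x = v \<otimes> a" using Suc.prems by auto
    then have "a \<in> carrier G" "v \<in> carrier G" using assms(1) words_closed[OF assms(1)] by auto
    moreover have "\<one> \<otimes> inv a \<in> words G A (Suc 0)" using va assms(2) by (intro words_snoc) auto
    ultimately have "inv x = inv a \<otimes> inv v" "inv a \<in> words G A 1"
      using va(3) by (simp_all add: inv_mult_group)
    then show ?thesis using words_mult[OF assms(1) \<open>inv a \<in> words G A 1\<close> Suc.IH[OF va(1)]] by simp
  qed
qed simp

declare words.simps(2) [simp del]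

text \<open>At \<open>x = g\<close> the conjugate is \<open>g\<close> itself, which leaves only
  \<open>g = \<one>\<close>; the second clause at \<open>x = \<one>\<close> excludes this.\<close>

lemma (in group) super_switching_notin:
  assumes "super_switching G W g" "g \<in> carrier G" "\<one> \<in> W"
  shows "g \<notin> W"
proof
  assume g: "g \<in> W"
  have "inv g \<otimes> g \<otimes> g = g" using assms(2) by simp
  then have "g = \<one>" using assms(1) g unfolding super_switching_def by metis
  then show False using assms g unfolding super_switching_def by (metis r_one)
qed

text \<open>The letter \<open>c\<close> is the second starting point of the walk. With it, the
  positions reached from \<open>\<one>\<close> and from \<open>c\<close> are words over the same
  alphabet.\<close>

definition alphabet :: "('a, 'b) monoid_scheme \<Rightarrow> 'a \<Rightarrow> (nat \<Rightarrow> 'a) \<Rightarrow> (nat \<Rightarrow> 'a) \<Rightarrow> nat \<Rightarrow> 'a set" where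
  "alphabet G c b q k = {c, inv\<^bsub>G\<^esub> c} \<union> (\<Union>j<k. {b j, inv\<^bsub>G\<^esub> (b j), q j, inv\<^bsub>G\<^esub> (q j)})"

lemma finite_alphabet: "finite (alphabet G c b q k)"
  by (simp add: alphabet_def)

lemma alphabet_mono: "k \<le> l \<Longrightarrow> alphabet G c b q k \<subseteq> alphabet G c b q l"
  by (fastforce simp: alphabet_def)

lemma (in group) alphabet_closed:
  assumes "c \<in> carrier G" "\<And>j. b j \<in> carrier G" "\<And>j. j < k \<Longrightarrow> q j \<in> carrier G"
  shows "alphabet G c b q k \<subseteq> carrier G"
  unfolding alphabet_def using assms by auto

lemma (in group) alphabet_inv:
  assumes "c \<in> carrier G" "\<And>j. b j \<in> carrier G" "\<And>j. j < k \<Longrightarrow> q j \<in> carrier G"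
  shows "m_inv G ` alphabet G c b q k \<subseteq> alphabet G c b q k"
  unfolding alphabet_def using assms by auto

lemma (in group) icc_ex_super_switching_sequence:
  assumes "icc G" "c \<in> carrier G" "\<And>j. b j \<in> carrier G"
  shows "\<exists>q. \<forall>k. q k \<in> carrier G \<and> super_switching G (words G (alphabet G c b q k) (M k)) (q k)"
proof (rule dependent_wellorder_choice)
  fix r :: 'a and f g :: "nat \<Rightarrow> 'a" and k :: nat
  assume "\<And>y. y < k \<Longrightarrow> f y = g y"
  then have "alphabet G c b f k = alphabet G c b g k" by (simp add: alphabet_def)
  then show "(r \<in> carrier G \<and> super_switching G (words G (alphabet G c b f k) (M k)) r) \<longleftrightarrow>
    (r \<in> carrier G \<and> super_switching G (words G (alphabet G c b g k) (M k)) r)" by simp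
next
  fix k :: nat and f :: "nat \<Rightarrow> 'a"
  assume *: "\<And>y. y < k \<Longrightarrow> f y \<in> carrier G \<and> super_switching G (words G (alphabet G c b f y) (M y)) (f y)"
  have "alphabet G c b f k \<subseteq> carrier G" using * assms by (intro alphabet_closed) auto
  then show "\<exists>r. r \<in> carrier G \<and> super_switching G (words G (alphabet G c b f k) (M k)) r"
    using icc_ex_super_switching[OF assms(1) finite_words[OF finite_alphabet] words_closed] by blast
qed

text \<open>The noise letters \<open>b j\<close> will enumerate the group, for full support; the letters \<open>q j\<close> are the switching elements.\<close>
fun letter :: "('a, 'b) monoid_scheme \<Rightarrow> (nat \<Rightarrow> 'a) \<Rightarrow> (nat \<Rightarrow> 'a) \<Rightarrow> nat \<times> bool \<times> bool \<Rightarrow> 'a" where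
  "letter G b q (j, noise, pos) =
    (if pos then (if noise then b j else q j) else inv\<^bsub>G\<^esub> (if noise then b j else q j))"

text \<open>Each level \<open>i\<close> below \<open>k\<close> contributes at most
  \<open>L i\<close> steps of waiting and the jump that leaves it.\<close>

definition word_bound :: "(nat \<Rightarrow> nat) \<Rightarrow> nat \<Rightarrow> nat" where
  "word_bound L k = (\<Sum>i<k. Suc (L i))"

lemma word_bound_mono: "k \<le> l \<Longrightarrow> word_bound L k \<le> word_bound L l"
  unfolding word_bound_def by (intro sum_mono2) auto

lemma word_bound_Suc: "word_bound L (Suc k) = word_bound L k + Suc (L k)"
  by (simp add: word_bound_def)

text \<open>\<open>state z k r x\<close>: a walk from \<open>z\<close> can be at \<open>x\<close>, where \<open>k = Suc j\<close> for the largest index \<open>j\<close> of a letter used so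
  far (\<open>k = 0\<close> if none), this letter was a switching letter \<open>q j\<close> or its inverse, it was used only once, and \<open>r \<le> L k\<close>
  steps were made after it; moreover the same held at each earlier time.\<close>
inductive state :: "('a, 'b) monoid_scheme \<Rightarrow> (nat \<Rightarrow> 'a) \<Rightarrow> (nat \<Rightarrow> 'a) \<Rightarrow> (nat \<Rightarrow> nat) \<Rightarrow> 'a \<Rightarrow> nat \<Rightarrow> nat \<Rightarrow> 'a \<Rightarrow> bool"
  for G :: "('a, 'b) monoid_scheme" and b q L z where
  start: "state G b q L z 0 0 z"
| jump: "state G b q L z k r x \<Longrightarrow> k \<le> j \<Longrightarrow>
    state G b q L z (Suc j) 0 (x \<otimes>\<^bsub>G\<^esub> letter G b q (j, False, s))"
| stay: "state G b q L z k r x \<Longrightarrow> Suc j < k \<Longrightarrow> r < L k \<Longrightarrow>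
    state G b q L z k (Suc r) (x \<otimes>\<^bsub>G\<^esub> letter G b q (j, t, s))"

text \<open>The length in \<open>switching\<close> covers products of three words, as needed in
  \<open>state_unique_level\<close>. \<open>Suc\<close> accounts for the starting point, and the
  index \<open>Suc (Suc k)\<close> for the \<open>L (Suc k)\<close> steps that may follow the letter
  \<open>q k\<close>.\<close>

locale switching_walk = group G for G (structure) +
  fixes c :: 'a and b q :: "nat \<Rightarrow> 'a" and L :: "nat \<Rightarrow> nat"
  assumes c_closed: "c \<in> carrier G" and c_nontrivial: "c \<noteq> \<one>"
    and b_closed: "b j \<in> carrier G" and q_closed: "q j \<in> carrier G"
    and switching: "super_switching G (words G (alphabet G c b q k) (3 * Suc (word_bound L (Suc (Suc k))))) (q k)"
begin

abbreviation "A k \<equiv> alphabet G c b q k"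

lemma A_closed: "A k \<subseteq> carrier G"
  by (rule alphabet_closed) (auto simp: c_closed b_closed q_closed)

lemma A_inv: "m_inv G ` A k \<subseteq> A k"
  by (rule alphabet_inv) (auto simp: c_closed b_closed q_closed)

lemma letter_closed: "letter G b q l \<in> carrier G"
  by (cases l) (auto simp: b_closed q_closed)

lemma letter_in_A: "j < k \<Longrightarrow> letter G b q (j, t, s) \<in> A k"
  by (auto simp: alphabet_def)

lemma state_closed: "state G b q L z k r x \<Longrightarrow> z \<in> carrier G \<Longrightarrow> x \<in> carrier G"
  by (induction rule: state.induct) (auto simp: letter_closed simp del: letter.simps)

lemma state_steps_le: "state G b q L z k r x \<Longrightarrow> r \<le> L k"
  by (induction rule: state.induct) auto

lemma state_in_words:
  assumes "state G b q L z k r x" "z \<in> carrier G"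
  shows "\<exists>w\<in>words G (A k) (word_bound L k + r). x = z \<otimes> w"
  using assms
proof (induction rule: state.induct)
  case start
  then show ?case using one_in_words by force
next
  case (jump k r x j s)
  then obtain w where w: "w \<in> words G (A k) (word_bound L k + r)" "x = z \<otimes> w" by blast
  let ?l = "letter G b q (j, False, s)"
  have "words G (A k) (word_bound L k + r) \<subseteq> words G (A (Suc j)) (word_bound L j + L j)"
  proof (rule words_mono[OF alphabet_mono])
    have "word_bound L k + r \<le> word_bound L k + L k" using state_steps_le jump.hyps(1) by simp
    also have "\<dots> \<le> word_bound L j + L j"
      using word_bound_mono[of "Suc k" "Suc j" L] jump.hyps(2) by (simp add: word_bound_Suc)
    finally show "word_bound L k + r \<le> word_bound L j + L j" .
  qed (use jump.hyps in simp)
  then have "w \<otimes> ?l \<in> words G (A (Suc j)) (Suc (word_bound L j + L j))"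
    using w letter_in_A[of j "Suc j"] by (intro words_snoc) auto
  moreover have "x \<otimes> ?l = z \<otimes> (w \<otimes> ?l)"
    using w words_closed[OF A_closed] letter_closed jump.prems by (simp add: m_assoc subset_iff del: letter.simps)
  ultimately show ?case by (auto simp: word_bound_Suc simp del: letter.simps)
next
  case (stay k r x j t s)
  then obtain w where w: "w \<in> words G (A k) (word_bound L k + r)" "x = z \<otimes> w" by blast
  let ?l = "letter G b q (j, t, s)"
  have "w \<otimes> ?l \<in> words G (A k) (Suc (word_bound L k + r))"
    using w letter_in_A[of j k] stay.hyps by (intro words_snoc) auto
  moreover have "x \<otimes> ?l = z \<otimes> (w \<otimes> ?l)"
    using w words_closed[OF A_closed] letter_closed stay.prems by (simp add: m_assoc subset_iff del: letter.simps)
  ultimately show ?case by (auto simp del: letter.simps)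
qed

lemma low_state_in_words:
  assumes "state G b q L z k r x" "z \<in> {\<one>, c}" "k \<le> j"
  shows "x \<in> words G (A j) (Suc (word_bound L (Suc j)))"
proof -
  have z: "z \<in> carrier G" using assms(2) c_closed by auto
  obtain w where w: "w \<in> words G (A k) (word_bound L k + r)" "x = z \<otimes> w"
    using state_in_words[OF assms(1) z] by blast
  have "word_bound L k + r \<le> word_bound L k + L k" using state_steps_le assms(1) by simp
  also have "\<dots> \<le> word_bound L (Suc j)"
    using word_bound_mono[of "Suc k" "Suc j" L] assms(3) by (simp add: word_bound_Suc)
  finally have "words G (A k) (word_bound L k + r) \<subseteq> words G (A j) (word_bound L (Suc j))"
    by (intro words_mono alphabet_mono assms(3))
  then have "w \<in> words G (A j) (word_bound L (Suc j))" using w(1) by blast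
  moreover have "z \<in> words G (A j) 1"
  proof (cases "z = \<one>")
    case False
    then have "\<one> \<otimes> z \<in> words G (A j) (Suc 0)"
      using assms(2) one_in_words by (intro words_snoc) (auto simp: alphabet_def)
    then show ?thesis using z by simp
  qed (simp add: one_in_words)
  ultimately have "z \<otimes> w \<in> words G (A j) (1 + word_bound L (Suc j))"
    by (intro words_mult[OF A_closed])
  then show ?thesis using w by simp
qed

text \<open>Every letter after the last jump has smaller index. So, for walks from
  \<open>\<one>\<close> or \<open>c\<close>, the position is a single switching letter between two
  words in the letters below \<open>j\<close>.\<close>

lemma state_cases_last_jump:
  assumes "state G b q L z k r x" "z \<in> carrier G"
  shows "(k = 0 \<and> x = z) \<or> (\<exists>j k' r' s v. k = Suc j \<and> k' \<le> j \<and> state G b q L z k' r' v \<and>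
    (\<exists>w\<in>words G (A j) r. x = v \<otimes> letter G b q (j, False, s) \<otimes> w))"
  using assms
proof (induction rule: state.induct)
  case (jump k r x j s)
  have "x \<otimes> letter G b q (j, False, s) = x \<otimes> letter G b q (j, False, s) \<otimes> \<one>"
    using letter_closed state_closed jump by (simp del: letter.simps)
  then show ?case using jump.hyps by (auto simp del: letter.simps)
next
  case (stay k r x i t s)
  then obtain j k' r' s' v w where *: "k = Suc j" "k' \<le> j" "state G b q L z k' r' v"
    "w \<in> words G (A j) r" "x = v \<otimes> letter G b q (j, False, s') \<otimes> w" by auto
  have "w \<otimes> letter G b q (i, t, s) \<in> words G (A j) (Suc r)"
    using *(1,4) stay.hyps by (intro words_snoc letter_in_A) auto
  moreover have "x \<otimes> letter G b q (i, t, s) = v \<otimes> letter G b q (j, False, s') \<otimes> (w \<otimes> letter G b q (i, t, s))"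
    using * words_closed[OF A_closed] letter_closed state_closed[OF *(3) stay.prems]
    by (simp add: m_assoc subset_iff del: letter.simps)
  ultimately show ?case using * by (metis)
qed simp

section \<open>Recovering the past of the walk from its position\<close>

lemma letter_notin_words:
  assumes "n \<le> 3 * Suc (word_bound L (Suc (Suc j)))"
  shows "letter G b q (j, False, s) \<notin> words G (A j) n"
proof
  let ?W = "words G (A j) (3 * Suc (word_bound L (Suc (Suc j))))"
  assume "letter G b q (j, False, s) \<in> words G (A j) n"
  then have "letter G b q (j, False, s) \<in> ?W" by (rule words_le[OF _ assms])
  then have "inv (letter G b q (j, False, s)) \<in> ?W" "letter G b q (j, False, s) \<in> ?W"
    using words_inv[OF A_closed A_inv] by auto
  then have "q j \<in> ?W" using q_closed by (auto split: if_splits)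
  then show False using super_switching_notin[OF switching q_closed one_in_words] by blast
qed

text \<open>If \<open>x\<close> also had a smaller level, it would be a short word over
  \<open>A j\<close>. Solving the decomposition of \<open>x\<close> for the last switching letter
  would then express that letter by three short words.\<close>

lemma state_unique_level:
  assumes x: "state G b q L z k r x" "state G b q L z' k' r' x" and z: "z \<in> {\<one>, c}" "z' \<in> {\<one>, c}"
  shows "\<not> k' < k"
proof
  assume less: "k' < k"
  have zG: "z \<in> carrier G" using z c_closed by auto
  obtain j l t s v w where *: "k = Suc j" "l \<le> j" "state G b q L z l t v"
    "w \<in> words G (A j) r" "x = v \<otimes> letter G b q (j, False, s) \<otimes> w"
    using state_cases_last_jump[OF x(1) zG] less by auto
  let ?n = "Suc (word_bound L (Suc (Suc j)))"
  have le: "Suc (word_bound L (Suc j)) \<le> ?n" "r \<le> ?n"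
    using state_steps_le[OF x(1)] *(1) by (auto simp: word_bound_Suc)
  have W: "v \<in> words G (A j) ?n" "x \<in> words G (A j) ?n" "w \<in> words G (A j) ?n"
    using words_le[OF low_state_in_words[OF *(3) z(1) *(2)] le(1)]
      words_le[OF low_state_in_words[OF x(2) z(2), of j] le(1)] words_le[OF *(4) le(2)] less *(1) by auto
  have cl: "v \<in> carrier G" "x \<in> carrier G" "w \<in> carrier G"
    using W by (auto intro: subsetD[OF words_closed[OF A_closed]])
  have "inv v \<otimes> x \<otimes> inv w \<in> words G (A j) (?n + ?n + ?n)"
    using W words_inv[OF A_closed A_inv] by (intro words_mult[OF A_closed]) auto
  moreover have "inv v \<otimes> x \<otimes> inv w = (inv v \<otimes> v) \<otimes> letter G b q (j, False, s) \<otimes> (w \<otimes> inv w)"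
    unfolding *(5) using cl letter_closed by (simp only: m_assoc inv_closed m_closed)
  then have "inv v \<otimes> x \<otimes> inv w = letter G b q (j, False, s)"
    using cl letter_closed by (simp del: letter.simps)
  ultimately show False using letter_notin_words[of "?n + ?n + ?n" j s] by simp
qed

text \<open>Cancelling reduces the equation to short words \<open>d\<close> and \<open>e\<close> on
  either side of the switching letters. For equal signs, \<open>d\<close> and \<open>e\<close> are
  conjugate by \<open>q j\<close>, which forces \<open>d = \<one>\<close>; for opposite signs, the
  second switching clause gives a contradiction.\<close>

lemma switching_decomposition_unique:
  assumes v: "v \<in> words G (A j) n" "v' \<in> words G (A j) n"
    and w: "w \<in> words G (A j) n" "w' \<in> words G (A j) n"
    and n: "n \<le> Suc (word_bound L (Suc (Suc j)))"
    and eq: "v \<otimes> letter G b q (j, False, s) \<otimes> w = v' \<otimes> letter G b q (j, False, s') \<otimes> w'"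
  shows "v = v'"
proof -
  let ?W = "words G (A j) (3 * Suc (word_bound L (Suc (Suc j))))"
  have cl: "v \<in> carrier G" "v' \<in> carrier G" "w \<in> carrier G" "w' \<in> carrier G"
    using v w by (auto intro: subsetD[OF words_closed[OF A_closed]])
  have W: "x \<otimes> y \<in> ?W" if "x \<in> words G (A j) n" "y \<in> words G (A j) n" for x y
    by (rule words_le[OF words_mult[OF A_closed that]]) (use n in simp)
  have mem: "inv v \<otimes> v' \<in> ?W" "inv v' \<otimes> v \<in> ?W" "w \<otimes> inv w' \<in> ?W" "w' \<otimes> inv w \<in> ?W"
    by (rule W; (rule words_inv[OF A_closed A_inv])?; fact v w)+
  let ?x = "letter G b q (j, False, s)" and ?y = "letter G b q (j, False, s')"
  have xy: "?x \<in> carrier G" "?y \<in> carrier G" by (rule letter_closed)+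
  have "inv v' \<otimes> (v \<otimes> ?x \<otimes> w) \<otimes> inv w = inv v' \<otimes> (v' \<otimes> ?y \<otimes> w') \<otimes> inv w" unfolding eq ..
  moreover have "inv v' \<otimes> (v \<otimes> ?x \<otimes> w) \<otimes> inv w = (inv v' \<otimes> v) \<otimes> ?x \<otimes> (w \<otimes> inv w)"
    using cl xy by (simp only: m_assoc inv_closed m_closed)
  moreover have "inv v' \<otimes> (v' \<otimes> ?y \<otimes> w') \<otimes> inv w = (inv v' \<otimes> v') \<otimes> ?y \<otimes> (w' \<otimes> inv w)"
    using cl xy by (simp only: m_assoc inv_closed m_closed)
  ultimately have 1: "(inv v' \<otimes> v) \<otimes> ?x = ?y \<otimes> (w' \<otimes> inv w)"
    using cl xy by (simp del: letter.simps)
  define d e where "d = inv v' \<otimes> v" and "e = w' \<otimes> inv w"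
  have de: "d \<in> carrier G" "e \<in> carrier G" using cl by (auto simp: d_def e_def)
  have deW: "d \<in> ?W" "e \<in> ?W" using mem by (auto simp: d_def e_def)
  have eq': "d \<otimes> ?x = ?y \<otimes> e" using 1 by (simp only: d_def e_def)
  have sw: "x \<noteq> \<one> \<Longrightarrow> inv (q j) \<otimes> x \<otimes> q j \<notin> ?W" "q j \<otimes> x \<otimes> q j \<notin> ?W" if "x \<in> ?W" for x
    using switching[of j] that unfolding super_switching_def by auto
  have "d = \<one>"
  proof (cases s; cases s')
    assume s: "s" "s'"
    have "inv (q j) \<otimes> (d \<otimes> q j) = inv (q j) \<otimes> (q j \<otimes> e)" using eq' s by simp
    then have "inv (q j) \<otimes> d \<otimes> q j = e" using de q_closed[of j] by (simp add: m_assoc[symmetric])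
    then show ?thesis using sw(1)[OF deW(1)] deW(2) by auto
  next
    assume s: "\<not> s" "\<not> s'"
    have "d \<otimes> inv (q j) \<otimes> q j = inv (q j) \<otimes> e \<otimes> q j" using eq' s by simp
    then have d: "d = inv (q j) \<otimes> e \<otimes> q j" using de q_closed[of j] by (simp add: m_assoc)
    then have "e = \<one>" using sw(1)[OF deW(2)] deW(1) by auto
    then show ?thesis using d q_closed[of j] by simp
  next
    assume s: "s" "\<not> s'"
    have "q j \<otimes> (d \<otimes> q j) = q j \<otimes> (inv (q j) \<otimes> e)" using eq' s by simp
    then have "q j \<otimes> d \<otimes> q j = e" using de q_closed[of j] by (simp add: m_assoc[symmetric])
    then show ?thesis using sw(2)[OF deW(1)] deW(2) by auto
  next
    assume s: "\<not> s" "s'"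
    have "d \<otimes> inv (q j) \<otimes> q j = q j \<otimes> e \<otimes> q j" using eq' s by simp
    then have "d = q j \<otimes> e \<otimes> q j" using de q_closed[of j] by (simp add: m_assoc)
    then show ?thesis using sw(2)[OF deW(2)] deW(1) by auto
  qed
  then have "v' \<otimes> (inv v' \<otimes> v) = v'" using cl by (simp add: d_def)
  then show ?thesis using cl by (simp add: m_assoc[symmetric])
qed

text \<open>A common position determines its level and the position before the last jump, which
  would be a common position of lower level. At level 0 the positions are \<open>\<one>\<close> and
  \<open>c\<close>.\<close>

theorem states_disjoint:
  assumes "state G b q L \<one> k r x"
  shows "\<not> state G b q L c k' r' x"
  using assms
proof (induction k arbitrary: r x k' r' rule: less_induct)
  case (less k)
  show ?case
  proof
    assume x': "state G b q L c k' r' x"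
    have "k' = k"
      using state_unique_level[OF less.prems x'] state_unique_level[OF x' less.prems] by auto
    note dec = state_cases_last_jump[OF less.prems one_closed] state_cases_last_jump[OF x' c_closed]
    show False
    proof (cases k)
      case 0
      then show False using dec \<open>k' = k\<close> c_nontrivial by auto
    next
      case (Suc j)
      obtain l t s v w where 1: "l \<le> j" "state G b q L \<one> l t v"
        "w \<in> words G (A j) r" "x = v \<otimes> letter G b q (j, False, s) \<otimes> w"
        using dec(1) Suc by auto
      obtain l' t' s' v' w' where 2: "l' \<le> j" "state G b q L c l' t' v'"
        "w' \<in> words G (A j) r'" "x = v' \<otimes> letter G b q (j, False, s') \<otimes> w'"
        using dec(2) Suc \<open>k' = k\<close> by auto
      let ?n = "Suc (word_bound L (Suc (Suc j)))"
      have le: "Suc (word_bound L (Suc j)) \<le> ?n" "r \<le> ?n" "r' \<le> ?n"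
        using state_steps_le[OF less.prems] state_steps_le[OF x'] Suc \<open>k' = k\<close> by (auto simp: word_bound_Suc)
      have "v = v'"
      proof (rule switching_decomposition_unique)
        show "v \<in> words G (A j) ?n" "v' \<in> words G (A j) ?n"
          using words_le[OF low_state_in_words[OF 1(2) _ 1(1)] le(1)]
            words_le[OF low_state_in_words[OF 2(2) _ 2(1)] le(1)] by auto
        show "w \<in> words G (A j) ?n" "w' \<in> words G (A j) ?n"
          using words_le[OF 1(3) le(2)] words_le[OF 2(3) le(3)] by auto
        show "v \<otimes> letter G b q (j, False, s) \<otimes> w = v' \<otimes> letter G b q (j, False, s') \<otimes> w'"
          using 1(4) 2(4) by simp
      qed simp
      then show False using less.IH[of l t v l' t'] 1 2 Suc by auto
    qed
  qed
qed

end

section \<open>Superharmonic bounds on escape probabilities\<close>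

definition markov_step ::
    "('a, 'b) monoid_scheme \<Rightarrow> ('l \<Rightarrow> real) \<Rightarrow> ('l \<Rightarrow> 'a) \<Rightarrow> ('a \<Rightarrow> real) \<Rightarrow> 'a \<Rightarrow> real" where
  "markov_step G w l f x = (\<Sum>\<^sub>\<infinity>i. w i * f (x \<otimes>\<^bsub>G\<^esub> l i))"

lemma weighted_summable:
  fixes w f :: "'l \<Rightarrow> real"
  assumes "\<And>i. 0 \<le> w i" "w summable_on UNIV" "\<And>i. 0 \<le> f i" "\<And>i. f i \<le> 1"
  shows "(\<lambda>i. w i * f i) summable_on UNIV"
  by (rule summable_on_comparison_test[OF assms(2)]) (use assms in \<open>auto intro: mult_left_le\<close>)

text \<open>Perron's method: the pointwise supremum of the subharmonic functions between \<open>1 - d\<^sub>1\<close> and \<open>d\<^sub>2\<close> is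
  harmonic, because \<open>markov_step\<close> maps this class of functions to itself and is monotone.\<close>
lemma (in group) ex_harmonic_between:
  fixes w :: "'l \<Rightarrow> real"
  assumes w: "\<And>i. 0 \<le> w i" "(w has_sum 1) UNIV" and l: "\<And>i. l i \<in> carrier G"
    and d1: "\<And>x. x \<in> carrier G \<Longrightarrow> 0 \<le> d1 x \<and> d1 x \<le> 1 \<and> markov_step G w l d1 x \<le> d1 x"
    and d2: "\<And>x. x \<in> carrier G \<Longrightarrow> 0 \<le> d2 x \<and> d2 x \<le> 1 \<and> markov_step G w l d2 x \<le> d2 x"
    and le: "\<And>x. x \<in> carrier G \<Longrightarrow> 1 \<le> d1 x + d2 x"
  shows "\<exists>f. \<forall>x\<in>carrier G. 1 - d1 x \<le> f x \<and> f x \<le> d2 x \<and> markov_step G w l f x = f x"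
proof -
  have ws: "w summable_on UNIV" using w(2) by (rule has_sum_imp_summable)
  have sm: "(\<lambda>i. w i * f (x \<otimes> l i)) summable_on UNIV"
    if "\<And>x. x \<in> carrier G \<Longrightarrow> 0 \<le> f x \<and> f x \<le> 1" "x \<in> carrier G" for f x
    by (rule weighted_summable[OF w(1) ws]) (use that l in auto)
  have mono: "markov_step G w l f x \<le> markov_step G w l g x"
    if "\<And>x. x \<in> carrier G \<Longrightarrow> 0 \<le> f x \<and> f x \<le> 1" "\<And>x. x \<in> carrier G \<Longrightarrow> 0 \<le> g x \<and> g x \<le> 1"
      "\<And>x. x \<in> carrier G \<Longrightarrow> f x \<le> g x" "x \<in> carrier G" for f g x
    unfolding markov_step_def by (rule infsum_mono[OF sm sm]) (use that l w(1) in \<open>auto intro: mult_left_mono\<close>)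
  have compl: "markov_step G w l (\<lambda>x. 1 - d1 x) x = 1 - markov_step G w l d1 x" if "x \<in> carrier G" for x
  proof -
    have "((\<lambda>i. w i - w i * d1 (x \<otimes> l i)) has_sum 1 - markov_step G w l d1 x) UNIV"
      unfolding markov_step_def by (intro has_sum_diff w(2) has_sum_infsum sm) (use d1 that in auto)
    then show ?thesis unfolding markov_step_def by (simp add: infsumI right_diff_distrib)
  qed
  define \<F> where "\<F> = {\<psi>. \<forall>x\<in>carrier G. 1 - d1 x \<le> \<psi> x \<and> \<psi> x \<le> d2 x \<and> \<psi> x \<le> markov_step G w l \<psi> x}"
  have F01: "0 \<le> \<psi> x \<and> \<psi> x \<le> 1" if "\<psi> \<in> \<F>" "x \<in> carrier G" for \<psi> x
    using that d1 d2 unfolding \<F>_def by force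
  define f where "f x = (SUP \<psi>\<in>\<F>. \<psi> x)" for x
  have start: "(\<lambda>x. 1 - d1 x) \<in> \<F>" unfolding \<F>_def using compl d1 le by fastforce
  have bdd: "bdd_above ((\<lambda>\<psi>. \<psi> x) ` \<F>)" if "x \<in> carrier G" for x
    using F01 that by (auto intro!: bdd_aboveI[of _ 1])
  have upper: "\<psi> x \<le> f x" if "\<psi> \<in> \<F>" "x \<in> carrier G" for \<psi> x
    unfolding f_def using that bdd by (intro cSUP_upper) auto
  have least: "f x \<le> u" if "\<And>\<psi>. \<psi> \<in> \<F> \<Longrightarrow> \<psi> x \<le> u" for x u
    unfolding f_def using that start by (intro cSUP_least) auto
  have f_d: "1 - d1 x \<le> f x" "f x \<le> d2 x" if "x \<in> carrier G" for x
    using upper[OF start that] least[of x "d2 x"] that by (auto simp: \<F>_def)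
  have f01: "0 \<le> f x \<and> f x \<le> 1" if "x \<in> carrier G" for x using f_d[OF that] d1 d2 that by force
  have sub: "f x \<le> markov_step G w l f x" if x: "x \<in> carrier G" for x
  proof (rule least)
    fix \<psi> assume \<psi>: "\<psi> \<in> \<F>"
    then have "\<psi> x \<le> markov_step G w l \<psi> x" using x by (simp add: \<F>_def)
    also have "\<dots> \<le> markov_step G w l f x" by (rule mono) (use F01 f01 upper \<psi> x in auto)
    finally show "\<psi> x \<le> markov_step G w l f x" .
  qed
  have up: "markov_step G w l f x \<le> d2 x" if x: "x \<in> carrier G" for x
  proof -
    have "markov_step G w l f x \<le> markov_step G w l d2 x" by (rule mono) (use f01 d2 f_d x in auto)
    then show ?thesis using d2 x by force
  qed
  \<comment> \<open>As \<open>f\<close> is the supremum of the class, membership yields the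
    inequality opposite to \<open>sub\<close>.\<close>
  have "markov_step G w l f \<in> \<F>"
    unfolding \<F>_def
  proof (intro CollectI ballI conjI)
    fix x assume x: "x \<in> carrier G"
    show "1 - d1 x \<le> markov_step G w l f x" using f_d(1)[OF x] sub[OF x] by linarith
    show "markov_step G w l f x \<le> markov_step G w l (markov_step G w l f) x"
    proof (rule mono)
      show "0 \<le> markov_step G w l f x \<and> markov_step G w l f x \<le> 1" if "x \<in> carrier G" for x
        using up[OF that] sub[OF that] f01[OF that] d2[OF that] by linarith
    qed (use f01 sub x in auto)
  qed (use up in blast)
  then have "markov_step G w l f x = f x" if "x \<in> carrier G" for x
    using upper[of "markov_step G w l f" x] sub that by force
  then show ?thesis using f_d by blast
qed

text \<open>This is \<open>16 / (16 + j) - 16 / (17 + j)\<close>, so that the tail from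
  \<open>k\<close> on is exactly \<open>16 / (16 + k)\<close>.\<close>

definition level_weight :: "nat \<Rightarrow> real" where
  "level_weight j = 16 / ((16 + real j) * (17 + real j))"

definition level_cdf :: "nat \<Rightarrow> real" where
  "level_cdf k = 1 - 16 / (16 + real k)"

text \<open>\<open>label_weight (j, noise, s)\<close>: the level \<open>j\<close> has a polynomial tail, so that ties for the maximal level are rare
  (a geometric tail would not do); a letter is noise with probability \<open>1 / (17 + j)\<close>.\<close>
fun label_weight :: "nat \<times> bool \<times> bool \<Rightarrow> real" where
  "label_weight (j, noise, pos) =
    level_weight j * (if noise then 1 / (17 + real j) else 1 - 1 / (17 + real j)) / 2"

lemma level_weight_pos: "0 < level_weight j"
  by (simp add: level_weight_def)

lemma label_weight_pos: "0 < label_weight i"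
  by (cases i) (auto simp: level_weight_pos field_simps intro!: mult_pos_pos)

lemma sum_level_weight: "(\<Sum>j<k. level_weight j) = level_cdf k"
proof (induction k)
  case (Suc k)
  have "1 - 16 / (16 + real k) + 16 / ((16 + real k) * (17 + real k)) = 1 - 16 / (17 + real k)"
    by (simp add: divide_simps add_pos_nonneg) (simp add: algebra_simps)
  then show ?case using Suc by (simp add: level_cdf_def level_weight_def)
qed (simp add: level_cdf_def)

lemma level_cdf_bounds: "0 \<le> level_cdf k" "level_cdf k < 1"
  by (simp_all add: level_cdf_def field_simps)

lemma level_cdf_mono: "k \<le> l \<Longrightarrow> level_cdf k \<le> level_cdf l"
  by (simp add: level_cdf_def frac_le)

lemma level_weight_has_sum: "(level_weight has_sum 1) UNIV"
proof (rule sums_nonneg_imp_has_sum)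
  have "(\<lambda>k. 1 - 16 / (16 + real k)) \<longlonglongrightarrow> 1 - 0"
    by (intro tendsto_intros tendsto_divide_0[OF tendsto_const] filterlim_at_top_imp_at_infinity
        filterlim_tendsto_add_at_top[OF tendsto_const] filterlim_real_sequentially)
  then show "level_weight sums 1" by (simp add: sums_def sum_level_weight level_cdf_def)
qed (use level_weight_pos in \<open>auto intro: less_imp_le\<close>)

lemma sum_bool_pairs:
  "(\<Sum>y\<in>UNIV. f y) = f (True, True) + f (True, False) + f (False, True) + f (False, False)"
  for f :: "bool \<times> bool \<Rightarrow> real"
  by (simp add: UNIV_Times_UNIV[symmetric] sum.cartesian_product[symmetric] UNIV_bool del: UNIV_Times_UNIV)

lemma label_weight_has_sum: "(label_weight has_sum 1) UNIV"
proof -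
  have "(label_weight has_sum 1) (UNIV \<times> UNIV)"
  proof (rule has_sum_SigmaI[OF _ level_weight_has_sum summable_on_SigmaI])
    have eq: "w = w * e / 2 + w * e / 2 + w * (1 - e) / 2 + w * (1 - e) / 2" for w e :: real
      by (simp add: algebra_simps)
    show "((\<lambda>y. label_weight (j, y)) has_sum level_weight j) UNIV" for j
    proof (rule has_sum_finiteI)
      show "level_weight j = (\<Sum>y\<in>UNIV. label_weight (j, y))"
        unfolding sum_bool_pairs label_weight.simps if_True if_False by (rule eq)
    qed simp
    then show "((\<lambda>y. label_weight (j, y)) has_sum level_weight j) UNIV" for j .
    show "level_weight summable_on UNIV" using level_weight_has_sum by (rule has_sum_imp_summable)
  qed (use label_weight_pos in \<open>auto intro: less_imp_le\<close>)
  then show ?thesis by simp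
qed

lemma label_weighted_infsum_le:
  assumes B: "\<And>i. 0 \<le> B i" "\<And>i. B i \<le> 1"
    and \<beta>: "\<And>j. (\<Sum>y\<in>UNIV. label_weight (j, y) * B (j, y)) \<le> \<beta> j" "\<And>j. 0 \<le> \<beta> j"
    and C: "\<And>n. (\<Sum>j<n. \<beta> j) \<le> C"
  shows "(\<Sum>\<^sub>\<infinity>i. label_weight i * B i) \<le> C"
proof (rule infsum_le_finite_sums)
  show "(\<lambda>i. label_weight i * B i) summable_on UNIV"
    using B label_weight_pos label_weight_has_sum
    by (intro weighted_summable) (auto intro: less_imp_le has_sum_imp_summable)
  fix F :: "(nat \<times> bool \<times> bool) set" assume F: "finite F"
  obtain n where n: "\<And>i. i \<in> F \<Longrightarrow> fst i < n"
    using finite_nat_set_iff_bounded[of "fst ` F"] F by auto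
  have "(\<Sum>i\<in>F. label_weight i * B i) \<le> (\<Sum>i\<in>{..<n} \<times> UNIV. label_weight i * B i)"
  proof (rule sum_mono2)
    show "0 \<le> label_weight i * B i" for i by (intro mult_nonneg_nonneg B less_imp_le label_weight_pos)
    show "F \<subseteq> {..<n} \<times> UNIV" using n by force
  qed simp
  also have "\<dots> = (\<Sum>j<n. \<Sum>y\<in>UNIV. label_weight (j, y) * B (j, y))"
    by (simp add: sum.cartesian_product del: label_weight.simps)
  also have "\<dots> \<le> (\<Sum>j<n. \<beta> j)" by (intro sum_mono \<beta>)
  also have "\<dots> \<le> C" by (rule C)
  finally show "(\<Sum>i\<in>F. label_weight i * B i) \<le> C" .
qed

text \<open>\<open>loss L k r\<close> bounds the probability that a walk in a state of level \<open>k\<close> and \<open>r\<close> later steps ever leaves the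
  states: the first summand accounts for ties and noise at new maxima, the second for waiting too long.\<close>
definition loss :: "(nat \<Rightarrow> nat) \<Rightarrow> nat \<Rightarrow> nat \<Rightarrow> real" where
  "loss L k r = 4 / (16 + real k) + level_cdf k ^ (L k - r)"

lemma loss_nonneg: "0 \<le> loss L k r"
  using level_cdf_bounds by (simp add: loss_def)

text \<open>A telescoping majorant: the terms behave like \<open>96 / j ^ 3\<close>, and the tails
  of their series like \<open>48 / k ^ 2\<close>.\<close>

lemma level_weight_tail_le:
  "level_weight j * (6 / (17 + real j)) \<le> 48 / (16 + real j)\<^sup>2 - 48 / (16 + real (Suc j))\<^sup>2"
proof -
  define x where "x = 16 + real j"
  have x: "x > 0" by (simp add: x_def)
  have "96 / (x * (x + 1)\<^sup>2) \<le> 48 / x\<^sup>2 - 48 / (x + 1)\<^sup>2"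
  proof -
    have "48 / x\<^sup>2 - 48 / (x + 1)\<^sup>2 - 96 / (x * (x + 1)\<^sup>2) = 48 / (x\<^sup>2 * (x + 1)\<^sup>2)"
      using x by (simp add: divide_simps add_pos_pos) (simp add: algebra_simps power2_eq_square)
    also have "\<dots> \<ge> 0" by simp
    finally show ?thesis by linarith
  qed
  moreover have "level_weight j * (6 / (17 + real j)) = 96 / (x * (x + 1)\<^sup>2)"
    by (simp add: level_weight_def x_def power2_eq_square add.commute)
  ultimately show ?thesis by (simp add: x_def add.commute add.left_commute)
qed

text \<open>The constant 4 in \<open>loss\<close> solves \<open>a = 1 + (a + 2) / 2\<close>. Among
  letters of level at least \<open>k - 1\<close>, a tie has probability \<open>1 / (16 + k)\<close>.
  A new maximum \<open>j\<close> costs at most \<open>6 / (17 + j)\<close>: 1 for noise, 4 for later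
  losses, 1 for waiting. Averaged over the tail this is at most \<open>3 / (16 + k)\<close>. A lower
  letter consumes one unit of patience, which the factor \<open>level_cdf k\<close> in the second
  summand pays for.\<close>

lemma loss_inequality:
  assumes r: "r < L k"
  shows "(\<Sum>j<n. level_weight j * (if Suc j < k then loss L k (Suc r) else if Suc j = k then 1 else 6 / (17 + real j))) \<le> loss L k r"
    (is "sum ?\<beta> {..<n} \<le> _")
proof -
  have pos: "0 \<le> ?\<beta> j" for j using level_weight_pos[of j] loss_nonneg[of L k "Suc r"] by auto
  have split: "sum ?\<beta> {..<k + m} \<le> sum ?\<beta> {..<k} + (48 / (16 + real k)\<^sup>2 - 48 / (16 + real (k + m))\<^sup>2)" for m
  proof (induction m)
    case (Suc m)
    then show ?case using level_weight_tail_le[of "k + m"] by simp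
  qed simp
  have "sum ?\<beta> {..<n} \<le> sum ?\<beta> {..<k + n}" using pos by (intro sum_mono2) auto
  also have "\<dots> \<le> sum ?\<beta> {..<k} + 48 / (16 + real k)\<^sup>2"
    using split[of n] by (smt (verit) divide_nonneg_nonneg zero_le_power2)
  also have "\<dots> \<le> loss L k r"
  proof (cases k)
    case 0
    then show ?thesis using level_cdf_bounds(1)[of 0] by (simp add: loss_def power2_eq_square)
  next
    case (Suc m)
    define x where "x = 16 + real m"
    have x: "x \<ge> 16" by (simp add: x_def)
    define p where "p = level_cdf k ^ (L k - Suc r)"
    have p: "0 \<le> p" using level_cdf_bounds by (simp add: p_def)
    have "sum ?\<beta> {..<k} = level_cdf m * loss L k (Suc r) + level_weight m"
      unfolding Suc by (simp add: sum_level_weight[symmetric] sum_distrib_right)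
    also have "\<dots> = (1 - 16 / x) * (4 / (x + 1)) + level_cdf m * p + 16 / (x * (x + 1))"
      unfolding loss_def p_def[symmetric]
      by (simp add: level_cdf_def level_weight_def x_def Suc distrib_left add.commute)
    finally have 1: "sum ?\<beta> {..<k} = \<dots>" .
    have "level_cdf m * p \<le> level_cdf k * p" using p level_cdf_mono[of m k] Suc by (intro mult_right_mono) auto
    also have "level_cdf k * p = level_cdf k ^ (L k - r)"
      using r by (simp add: p_def Suc_diff_Suc flip: power_Suc)
    finally have 2: "level_cdf m * p \<le> level_cdf k ^ (L k - r)" .
    have "4 / (x + 1) - ((1 - 16 / x) * (4 / (x + 1)) + 16 / (x * (x + 1)) + 48 / (x + 1)\<^sup>2) = 48 / (x * (x + 1)\<^sup>2)"
      using x by (simp add: divide_simps) (simp add: algebra_simps power2_eq_square)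
    moreover have "48 / (x * (x + 1)\<^sup>2) \<ge> 0" using x by simp
    ultimately have 3: "(1 - 16 / x) * (4 / (x + 1)) + 16 / (x * (x + 1)) + 48 / (x + 1)\<^sup>2 \<le> 4 / (x + 1)" by linarith
    have k: "16 + real k = x + 1" by (simp add: x_def Suc)
    have "loss L k r = 4 / (x + 1) + level_cdf k ^ (L k - r)" by (simp add: loss_def k)
    then show ?thesis unfolding 1 k using 2 3 by linarith
  qed
  finally show ?thesis .
qed

lemma ex_patience:
  "\<exists>L. \<forall>k. level_cdf k ^ L k \<le> 1 / (16 + real k)"
proof -
  have "\<exists>n. level_cdf k ^ n \<le> 1 / (16 + real k)" for k
    using real_arch_pow_inv[of "1 / (16 + real k)" "level_cdf k"] level_cdf_bounds by (auto intro: less_imp_le)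
  then show ?thesis by metis
qed

text \<open>A position may belong to several states, so the best bound is taken; the inserted 1 is
  the trivial bound and the value at positions that belong to none.\<close>

definition escape :: "('a, 'b) monoid_scheme \<Rightarrow> (nat \<Rightarrow> 'a) \<Rightarrow> (nat \<Rightarrow> 'a) \<Rightarrow> (nat \<Rightarrow> nat) \<Rightarrow> 'a \<Rightarrow> 'a \<Rightarrow> real" where
  "escape G b q L z x = Inf (insert 1 {loss L k r | k r. state G b q L z k r x})"

lemma escape_bdd: "bdd_below (insert 1 {loss L k r | k r. state G b q L z k r x})"
  by (rule bdd_belowI[of _ 0]) (auto simp: loss_nonneg)

lemma escape_nonneg: "0 \<le> escape G b q L z x"
  unfolding escape_def by (rule cInf_greatest) (auto simp: loss_nonneg)

lemma escape_le_one: "escape G b q L z x \<le> 1"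
  unfolding escape_def by (rule cInf_lower[OF _ escape_bdd]) simp

lemma escape_le: "state G b q L z k r x \<Longrightarrow> escape G b q L z x \<le> loss L k r"
  unfolding escape_def by (rule cInf_lower[OF _ escape_bdd]) auto

lemma escape_eq_one: "(\<And>k r. \<not> state G b q L z k r x) \<Longrightarrow> escape G b q L z x = 1"
  unfolding escape_def by simp

text \<open>Since \<open>escape\<close> is an infimum, it suffices to bound one step by 1 and by the
  loss of each state at \<open>x\<close>. The letters are split by level: below the maximum the walk
  stays, at the maximum it is given up, above it a switching letter jumps and noise is given
  up.\<close>

lemma (in switching_walk) escape_superharmonic:
  assumes L: "\<And>k. level_cdf k ^ L k \<le> 1 / (16 + real k)"
  shows "markov_step G label_weight (letter G b q) (escape G b q L z) x \<le> escape G b q L z x"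
proof -
  let ?B = "\<lambda>i. escape G b q L z (x \<otimes> letter G b q i)"
  have le1: "markov_step G label_weight (letter G b q) (escape G b q L z) x \<le> 1"
  proof -
    have "(\<Sum>\<^sub>\<infinity>i. label_weight i * ?B i) \<le> infsum label_weight UNIV"
    proof (rule infsum_mono)
      show ws: "label_weight summable_on UNIV" using label_weight_has_sum by (rule has_sum_imp_summable)
      show "(\<lambda>i. label_weight i * ?B i) summable_on UNIV"
        by (rule weighted_summable[OF less_imp_le[OF label_weight_pos] ws escape_nonneg escape_le_one])
      show "label_weight i * ?B i \<le> label_weight i" for i
        by (rule mult_left_le[OF escape_le_one less_imp_le[OF label_weight_pos]])
    qed
    then show ?thesis using label_weight_has_sum by (simp add: markov_step_def infsumI)
  qed
  have main: "markov_step G label_weight (letter G b q) (escape G b q L z) x \<le> loss L k r"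
    if st: "state G b q L z k r x" for k r
  proof (cases "r < L k")
    case False
    \<comment> \<open>Once patience is exhausted the exponent \<open>L k - r\<close> is 0, so the
      loss is already at least 1.\<close>
    then have "1 \<le> loss L k r" by (simp add: loss_def)
    then show ?thesis using le1 by linarith
  next
    case r: True
    define \<gamma> where "\<gamma> j = (if Suc j < k then loss L k (Suc r) else if Suc j = k then 1 else 6 / (17 + real j))" for j
    have ring: "w * e / 2 * u1 + w * e / 2 * u2 + w * e' / 2 * v1 + w * e' / 2 * v2 =
        (w / 2) * (e * (u1 + u2) + e' * (v1 + v2))" for w e e' u1 u2 v1 v2 :: real
      by (simp add: algebra_simps)
    have convex: "e * g + (1 - e) * g \<le> g" for e g :: real by (simp add: algebra_simps)
    have split: "(\<Sum>y\<in>UNIV. label_weight (j, y) * ?B (j, y)) =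
        (level_weight j / 2) * ((1 / (17 + real j)) * (?B (j, True, True) + ?B (j, True, False)) +
          (1 - 1 / (17 + real j)) * (?B (j, False, True) + ?B (j, False, False)))" for j
      unfolding sum_bool_pairs label_weight.simps if_True if_False by (rule ring)
    have combine: "(level_weight j / 2) * ((1 / (17 + real j)) * (u1 + u2) + (1 - 1 / (17 + real j)) * (v1 + v2)) \<le> level_weight j * g"
      if "u1 \<le> u" "u2 \<le> u" "v1 \<le> v" "v2 \<le> v" "(1 / (17 + real j)) * u + (1 - 1 / (17 + real j)) * v \<le> g" for j u1 u2 v1 v2 u v g
    proof -
      have "(1 / (17 + real j)) * (u1 + u2) \<le> (1 / (17 + real j)) * (2 * u)"
        using that by (intro mult_left_mono) auto
      moreover have "(1 - 1 / (17 + real j)) * (v1 + v2) \<le> (1 - 1 / (17 + real j)) * (2 * v)"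
        using that by (intro mult_left_mono) (auto simp: field_simps)
      ultimately have "(1 / (17 + real j)) * (u1 + u2) + (1 - 1 / (17 + real j)) * (v1 + v2) \<le> 2 * g"
        using that(5) by linarith
      then have "(level_weight j / 2) * ((1 / (17 + real j)) * (u1 + u2) + (1 - 1 / (17 + real j)) * (v1 + v2)) \<le> (level_weight j / 2) * (2 * g)"
        using level_weight_pos[of j] by (intro mult_left_mono) auto
      then show ?thesis by simp
    qed
    have level: "(\<Sum>y\<in>UNIV. label_weight (j, y) * ?B (j, y)) \<le> level_weight j * \<gamma> j" for j
    proof -
      consider "Suc j < k" | "Suc j = k" | "k \<le> j" by linarith
      then show ?thesis
      proof cases
        case 1
        then have v: "?B (j, t, s) \<le> \<gamma> j" for t s
          using escape_le[OF state.stay[OF st 1 r]] by (simp add: \<gamma>_def)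
        then show ?thesis unfolding split by (intro combine[OF v v v v] convex)
      next
        case 2
        then have v: "?B (j, t, s) \<le> \<gamma> j" for t s by (simp add: \<gamma>_def escape_le_one)
        then show ?thesis unfolding split by (intro combine[OF v v v v] convex)
      next
        case 3
        \<comment> \<open>The 5 is the 4 of \<open>loss\<close> plus 1 from the choice of
          \<open>L\<close>, which bounds the waiting summand at a fresh level.\<close>
        have "loss L (Suc j) 0 \<le> 5 / (17 + real j)"
          using L[of "Suc j"] by (simp add: loss_def add.commute add_divide_distrib[symmetric])
        then have v: "?B (j, False, s) \<le> 5 / (17 + real j)" for s
          using escape_le[OF state.jump[OF st 3, of s]] by linarith
        have "(1 / (17 + real j)) * 1 + (1 - 1 / (17 + real j)) * (5 / (17 + real j)) \<le> 1 / (17 + real j) + 5 / (17 + real j)"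
          by (intro add_mono mult_left_le_one_le) auto
        also have "\<dots> = \<gamma> j" using 3 by (simp add: \<gamma>_def add_divide_distrib[symmetric])
        finally show ?thesis unfolding split by (intro combine[OF escape_le_one escape_le_one v v])
      qed
    qed
    show ?thesis unfolding markov_step_def
    proof (rule label_weighted_infsum_le[OF escape_nonneg escape_le_one level])
      show "0 \<le> level_weight j * \<gamma> j" for j
        using level_weight_pos[of j] loss_nonneg[of L k "Suc r"] by (auto simp: \<gamma>_def)
      show "(\<Sum>j<n. level_weight j * \<gamma> j) \<le> loss L k r" for n
        unfolding \<gamma>_def by (rule loss_inequality[of r L k, OF r])
    qed
  qed
  show ?thesis
    unfolding escape_def[of G b q L z x] by (rule cInf_greatest) (use le1 main in \<open>auto simp: escape_def\<close>)
qed

theorem (in group) icc_ex_nonconstant_harmonic: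
  assumes "icc G" "\<And>j. b j \<in> carrier G"
  shows "\<exists>q f. range q \<subseteq> carrier G \<and>
    (\<forall>x\<in>carrier G. 0 \<le> f x \<and> f x \<le> 1 \<and> markov_step G label_weight (letter G b q) f x = f x) \<and>
    (\<exists>x\<in>carrier G. \<exists>y\<in>carrier G. f x \<noteq> f y)"
proof -
  obtain c where c: "c \<in> carrier G" "c \<noteq> \<one>" using assms(1) one_closed unfolding icc_def by blast
  obtain L where L: "\<And>k. level_cdf k ^ L k \<le> 1 / (16 + real k)" using ex_patience by metis
  obtain q where q: "\<forall>k. q k \<in> carrier G \<and>
      super_switching G (words G (alphabet G c b q k) (3 * Suc (word_bound L (Suc (Suc k))))) (q k)"
    using icc_ex_super_switching_sequence[of c b "\<lambda>k. 3 * Suc (word_bound L (Suc (Suc k)))"] assms c(1) by blast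
  interpret switching_walk G c b q L
    by unfold_locales (use c q assms(2) in auto)
  \<comment> \<open>Both starting values lie below 1/2, so a harmonic function between the bounds is
    at least 11/16 at \<open>\<one>\<close> and at most 5/16 at \<open>c\<close>.\<close>
  have start: "escape G b q L z z \<le> 5 / 16" for z
  proof -
    have "loss L 0 0 \<le> 5 / 16" using L[of 0] by (simp add: loss_def)
    then show ?thesis using escape_le[OF state.start, of G b q L z] by linarith
  qed
  have "\<exists>f. \<forall>x\<in>carrier G. 1 - escape G b q L \<one> x \<le> f x \<and> f x \<le> escape G b q L c x \<and>
      markov_step G label_weight (letter G b q) f x = f x"
  proof (rule ex_harmonic_between)
    \<comment> \<open>No position is a state for both starting points, so one of the two summands
      equals 1.\<close>
    show "1 \<le> escape G b q L \<one> x + escape G b q L c x" for x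
      using states_disjoint escape_eq_one[of G b q L _ x] escape_nonneg[of G b q L _ x]
      by (metis add_increasing add_increasing2 order_refl)
  qed (use label_weight_pos label_weight_has_sum letter_closed escape_superharmonic[OF L] escape_nonneg escape_le_one
      in \<open>auto intro: less_imp_le\<close>)
  then obtain f where f: "\<And>x. x \<in> carrier G \<Longrightarrow> 1 - escape G b q L \<one> x \<le> f x \<and> f x \<le> escape G b q L c x \<and>
      markov_step G label_weight (letter G b q) f x = f x" by blast
  have "0 \<le> f x \<and> f x \<le> 1" if "x \<in> carrier G" for x
    using f[OF that] escape_le_one[of G b q L \<one> x] escape_le_one[of G b q L c x] by linarith
  moreover have "f \<one> \<noteq> f c" using f[OF one_closed] f[OF c(1)] start[of \<one>] start[of c] by linarith
  ultimately show ?thesis using f q c(1) by (intro exI[of _ q] exI[of _ f]) auto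
qed

section \<open>Measures on groups with ICC quotients\<close>

definition pushforward :: "('l \<Rightarrow> real) \<Rightarrow> ('l \<Rightarrow> 'a) \<Rightarrow> 'a \<Rightarrow> real" where
  "pushforward w l g = infsum w {i. l i = g}"

lemma pushforward_has_sum:
  assumes w: "w summable_on UNIV" and l: "\<And>i. l i \<in> C"
    and s: "(\<lambda>i. w i * f (l i)) summable_on UNIV"
  shows "((\<lambda>g. pushforward w l g * f g) has_sum (\<Sum>\<^sub>\<infinity>i. w i * f (l i))) C"
proof (rule has_sum_SigmaD)
  have "bij_betw (\<lambda>i. (l i, i)) UNIV (Sigma C (\<lambda>g. {i. l i = g}))"
    by (rule bij_betwI[of _ _ _ snd]) (use l in auto)
  then have "((\<lambda>(g, i). w i * f (l i)) has_sum (\<Sum>\<^sub>\<infinity>i. w i * f (l i))) (Sigma C (\<lambda>g. {i. l i = g})) \<longleftrightarrow>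
      ((\<lambda>i. w i * f (l i)) has_sum (\<Sum>\<^sub>\<infinity>i. w i * f (l i))) UNIV"
    by (subst has_sum_reindex_bij_betw[symmetric]) auto
  then show "((\<lambda>(g, i). w i * f (l i)) has_sum (\<Sum>\<^sub>\<infinity>i. w i * f (l i))) (Sigma C (\<lambda>g. {i. l i = g}))"
    using s by simp
  fix g
  have "w summable_on {i. l i = g}" using w by (rule summable_on_subset_banach) simp
  then have "((\<lambda>i. w i * f g) has_sum (pushforward w l g * f g)) {i. l i = g}"
    unfolding pushforward_def by (intro has_sum_cmult_left has_sum_infsum)
  then show "((\<lambda>i. case (g, i) of (g, i) \<Rightarrow> w i * f (l i)) has_sum (pushforward w l g * f g)) {i. l i = g}"
    by (rule has_sum_cong[THEN iffD1, rotated]) simp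
qed

lemma pushforward_ge:
  assumes "w summable_on UNIV" "\<And>i. 0 \<le> w i"
  shows "w i \<le> pushforward w l (l i)"
proof -
  have "w summable_on {j. l j = l i}" using assms(1) by (rule summable_on_subset_banach) simp
  then have "sum w {i} \<le> infsum w {j. l j = l i}" by (rule finite_sum_le_infsum) (use assms(2) in auto)
  then show ?thesis by (simp add: pushforward_def)
qed

text \<open>Merging labels does not increase entropy: on a fibre each weight is at most the total
  mass of the fibre, so \<open>- ln\<close> of the total is at most \<open>- ln\<close> of each
  weight.\<close>

lemma pushforward_entropy_summable:
  assumes w: "\<And>i. 0 < w i" "(w has_sum 1) UNIV" and l: "\<And>i. l i \<in> C"
    and s: "(\<lambda>i. - (w i * ln (w i))) summable_on UNIV"
  shows "(\<lambda>g. - (pushforward w l g * ln (pushforward w l g))) summable_on C"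
proof -
  let ?E = "\<lambda>i. - (w i * ln (w i))" and ?\<mu> = "pushforward w l"
  have ws: "w summable_on UNIV" using w(2) by (rule has_sum_imp_summable)
  have nn: "0 \<le> ?\<mu> g" for g unfolding pushforward_def using w(1) by (intro infsum_nonneg) (auto intro: less_imp_le)
  have sub: "w summable_on {i. l i = g}" "?E summable_on {i. l i = g}" for g
    using summable_on_subset_banach[OF ws] summable_on_subset_banach[OF s] by auto
  have "(pushforward ?E l has_sum infsum ?E UNIV) C"
    using pushforward_has_sum[OF s l, of "\<lambda>_. 1"] s by simp
  then show ?thesis
  proof (rule summable_on_comparison_test[OF has_sum_imp_summable])
    fix g
    have le1: "?\<mu> g \<le> 1"
      unfolding pushforward_def using infsum_mono2[OF sub(1) ws] w by (simp add: infsumI less_imp_le)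
    show "0 \<le> - (?\<mu> g * ln (?\<mu> g))"
      using nn[of g] le1 by (cases "?\<mu> g = 0") (auto intro: mult_nonneg_nonpos)
    have "((\<lambda>i. w i * - ln (?\<mu> g)) has_sum (?\<mu> g * - ln (?\<mu> g))) {i. l i = g}"
      unfolding pushforward_def by (intro has_sum_cmult_left has_sum_infsum sub)
    moreover have "(?E has_sum pushforward ?E l g) {i. l i = g}"
      unfolding pushforward_def by (intro has_sum_infsum sub)
    ultimately have "?\<mu> g * - ln (?\<mu> g) \<le> pushforward ?E l g"
    proof (rule has_sum_mono)
      fix i assume "i \<in> {i. l i = g}"
      then have "w i \<le> ?\<mu> g" using pushforward_ge[OF ws less_imp_le[OF w(1)], of i l] by simp
      then have "ln (w i) \<le> ln (?\<mu> g)" using w(1)[of i] by simp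
      then show "w i * - ln (?\<mu> g) \<le> ?E i" using w(1)[of i] by (simp add: mult_left_mono)
    qed
    then show "- (?\<mu> g * ln (?\<mu> g)) \<le> pushforward ?E l g" by simp
  qed
qed

text \<open>The exponent 3/4 is above 1/2: for weights of order \<open>1 / j ^ 2\<close> it gives
  the summable order \<open>j powr (-3/2)\<close>.\<close>

lemma minus_mult_ln_le:
  fixes t :: real
  assumes "0 < t"
  shows "- (t * ln t) \<le> 4 * t powr (3/4)"
proof -
  have "- ln t = 4 * ln (t powr (-1/4))" using assms by (simp add: ln_powr)
  also have "\<dots> \<le> 4 * t powr (-1/4)" using ln_le_minus_one[of "t powr (-1/4)"] assms by simp
  finally have "t * - ln t \<le> t * (4 * t powr (-1/4))" using assms by (intro mult_left_mono) auto
  also have "\<dots> = 4 * (t * t powr (-1/4))" by simp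
  also have "t * t powr (-1/4) = t powr (3/4)" using assms powr_mult_base[of t "-1/4"] by simp
  finally show ?thesis by simp
qed

lemma label_weight_le: "label_weight (j, y) \<le> 16 / (real (Suc j))\<^sup>2"
proof -
  obtain t s where y: "y = (t, s)" by (cases y)
  have "level_weight j * (if t then 1 / (17 + real j) else 1 - 1 / (17 + real j)) \<le> level_weight j * 2"
    using level_weight_pos[of j] by (intro mult_left_mono) (auto simp: field_simps)
  then have "label_weight (j, y) \<le> level_weight j" unfolding y label_weight.simps by linarith
  also have "\<dots> \<le> 16 / (real (Suc j))\<^sup>2"
    unfolding level_weight_def power2_eq_square by (intro divide_left_mono mult_mono) auto
  finally show ?thesis .
qed

lemma label_entropy_summable: "(\<lambda>i. - (label_weight i * ln (label_weight i))) summable_on UNIV"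
proof -
  \<comment> \<open>32 is the 4 of \<open>minus_mult_ln_le\<close> times
    \<open>16 powr (3/4) = 8\<close>; the four labels of a level together give the 128
    below.\<close>
  define h where "h i = 32 * real (Suc (fst i)) powr (-3/2)" for i :: "nat \<times> bool \<times> bool"
  have "summable (\<lambda>j. real j powr (-3/2))" by (subst summable_real_powr_iff) simp
  then have "summable (\<lambda>j. 128 * real (Suc j) powr (-3/2))"
    by (intro summable_mult) (subst summable_Suc_iff)
  then have "(\<lambda>j. 128 * real (Suc j) powr (-3/2)) summable_on UNIV"
    by (rule summable_nonneg_imp_summable_on) simp
  then have "h summable_on (UNIV \<times> UNIV)"
  proof (rule summable_on_SigmaI[rotated])
    show "((\<lambda>y. h (j, y)) has_sum 128 * real (Suc j) powr (-3/2)) UNIV" for j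
      by (rule has_sum_finiteI) (simp_all add: h_def sum_bool_pairs)
  qed (simp add: h_def)
  then have "h summable_on UNIV" by simp
  then show ?thesis
  proof (rule summable_on_comparison_test)
    fix i :: "nat \<times> bool \<times> bool"
    obtain j y where i: "i = (j, y)" by (cases i)
    have "- (label_weight i * ln (label_weight i)) \<le> 4 * label_weight i powr (3/4)"
      by (rule minus_mult_ln_le[OF label_weight_pos])
    also have "\<dots> \<le> 4 * (16 / (real (Suc j))\<^sup>2) powr (3/4)"
      using label_weight_le[of j y] label_weight_pos[of i] unfolding i
      by (intro mult_left_mono powr_mono2) auto
    also have "(16 / (real (Suc j))\<^sup>2) powr (3/4) = 8 * real (Suc j) powr (-3/2)"
    proof -
      have "(16::real) powr (3/4) = (2 powr 4) powr (3/4)" by simp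
      then have "(16::real) powr (3/4) = 8" by (simp only: powr_powr) simp
      moreover have "(x\<^sup>2) powr (3/4) = x powr (3/2)" if "x > 0" for x :: real
        using that powr_powr[of x 2 "3/4"] by simp
      ultimately show ?thesis
        using powr_divide[of 16 "(real (Suc j))\<^sup>2" "3/4"] powr_minus_divide[of "real (Suc j)" "3/2"] by simp
    qed
    finally show "- (label_weight i * ln (label_weight i)) \<le> h i" by (simp add: h_def i)
    have "label_weight i \<le> 1"
    proof -
      have "sum label_weight {i} \<le> 1"
        by (rule finite_sum_le_has_sum[OF label_weight_has_sum]) (use label_weight_pos in \<open>auto intro: less_imp_le\<close>)
      then show ?thesis by simp
    qed
    then show "0 \<le> - (label_weight i * ln (label_weight i))"
      using label_weight_pos[of i] by (simp add: mult_nonneg_nonpos)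
  qed
qed

text \<open>The walk on the quotient is lifted letter by letter: \<open>a\<close> enumerates
  \<open>G\<close> itself, not just the quotient, and \<open>p\<close> lifts the switching elements.
  A harmonic function on the quotient then composes with the projection.\<close>

lemma (in group) icc_quotient_imp_not_liouville_measure:
  assumes "countable (carrier G)" "has_icc_quotient G"
  shows "\<exists>\<mu>. prob_measure_on G \<mu> \<and> msupp G \<mu> = carrier G \<and> symmetric_measure G \<mu>
    \<and> finite_entropy G \<mu> \<and> \<not> liouville G \<mu>"
proof -
  obtain N where N: "N \<lhd> G" "icc (G Mod N)" using assms(2) unfolding has_icc_quotient_def by blast
  interpret h: group_hom G "G Mod N" "\<lambda>x. N #> x" by (rule group_hom_Mod[OF N(1)])
  define a where "a = from_nat_into (carrier G)"
  have a: "range a = carrier G" "\<And>j. a j \<in> carrier G"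
    unfolding a_def using range_from_nat_into[OF _ assms(1)] from_nat_into[of "carrier G"] by auto
  define b where "b j = N #> a j" for j
  have b: "b j \<in> carrier (G Mod N)" for j unfolding b_def using a(2) h.hom_closed by blast
  obtain q f where qf: "range q \<subseteq> carrier (G Mod N) \<and>
      (\<forall>x\<in>carrier (G Mod N). 0 \<le> f x \<and> f x \<le> 1 \<and>
        markov_step (G Mod N) label_weight (letter (G Mod N) b q) f x = f x) \<and>
      (\<exists>x\<in>carrier (G Mod N). \<exists>y\<in>carrier (G Mod N). f x \<noteq> f y)"
    using h.H.icc_ex_nonconstant_harmonic[of b, OF N(2) b] by (elim exE) (rule that)
  note q = conjunct1[OF qf] and f = bspec[OF conjunct1[OF conjunct2[OF qf]]] and ne = conjunct2[OF conjunct2[OF qf]]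
  have "\<forall>j. \<exists>x\<in>carrier G. N #> x = q j"
  proof
    fix j
    have "q j \<in> (\<lambda>x. N #> x) ` carrier G" using range_subsetD[OF q] unfolding carrier_FactGroup .
    then show "\<exists>x\<in>carrier G. N #> x = q j" by (rule imageE) auto
  qed
  then obtain p where p: "\<And>j. p j \<in> carrier G" "\<And>j. N #> p j = q j" by metis
  define l where "l = letter G a p"
  have l: "l i \<in> carrier G" for i unfolding l_def using a(2) p(1) by (cases i) auto
  have Nl: "N #> l i = letter (G Mod N) b q i" for i
    unfolding l_def using a(2) p h.hom_inv by (cases i) (auto simp: b_def)
  define \<mu> where "\<mu> = pushforward label_weight l"
  have ws: "label_weight summable_on UNIV" using label_weight_has_sum by (rule has_sum_imp_summable)
  have \<mu>_pos: "0 < \<mu> g" if "g \<in> carrier G" for g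
  proof -
    \<comment> \<open>Every element is a noise letter, and every label has positive weight.\<close>
    obtain j where "g = a j" using a(1) \<open>g \<in> carrier G\<close> by auto
    then have "g = l (j, True, True)" by (simp add: l_def)
    then show ?thesis
      using pushforward_ge[OF ws less_imp_le[OF label_weight_pos], of "(j, True, True)" l] label_weight_pos[of "(j, True, True)"]
      unfolding \<mu>_def by simp
  qed
  have prob: "prob_measure_on G \<mu>"
  proof -
    have "((\<lambda>g. \<mu> g * 1) has_sum (\<Sum>\<^sub>\<infinity>i. label_weight i * 1)) (carrier G)"
      unfolding \<mu>_def by (rule pushforward_has_sum[where f = "\<lambda>_. 1"]) (use ws l in auto)
    then show ?thesis
      using \<mu>_pos infsumI[OF label_weight_has_sum] by (auto simp: prob_measure_on_def intro: less_imp_le)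
  qed
  have sym: "\<mu> g = \<mu> (inv g)" if g: "g \<in> carrier G" for g
  proof -
    \<comment> \<open>Changing the sign of a label inverts its letter and preserves its
      weight.\<close>
    define flip where "flip = (\<lambda>(j::nat, t::bool, s). (j, t, \<not> s))"
    have l_flip: "l (flip i) = inv (l i)" for i
      unfolding l_def flip_def using a(2) p(1) by (cases i) auto
    have "bij_betw flip {i. l i = g} {i. l i = inv g}"
    proof (rule bij_betwI[of _ _ _ flip])
      show "flip \<in> {i. l i = inv g} \<rightarrow> {i. l i = g}" using l_flip g by auto
    qed (use l_flip in \<open>auto simp: flip_def\<close>)
    then have "infsum (\<lambda>i. label_weight (flip i)) {i. l i = g} = infsum label_weight {i. l i = inv g}"
      by (rule infsum_reindex_bij_betw)
    moreover have "label_weight (flip i) = label_weight i" for i by (cases i) (simp add: flip_def)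
    ultimately show ?thesis by (simp add: \<mu>_def pushforward_def)
  qed
  have "harmonic G \<mu> (\<lambda>x. f (N #> x))"
    unfolding harmonic_def
  proof
    fix k assume k: "k \<in> carrier G"
    let ?f = "\<lambda>g. f (N #> (k \<otimes> g))"
    have "((\<lambda>g. \<mu> g * ?f g) has_sum (\<Sum>\<^sub>\<infinity>i. label_weight i * ?f (l i))) (carrier G)"
      unfolding \<mu>_def
    proof (rule pushforward_has_sum[OF ws l])
      have "0 \<le> ?f (l i)" "?f (l i) \<le> 1" for i using f[OF h.hom_closed[of "k \<otimes> l i"]] k l by auto
      then show "(\<lambda>i. label_weight i * ?f (l i)) summable_on UNIV"
        by (intro weighted_summable ws less_imp_le[OF label_weight_pos])
    qed
    also have "(\<Sum>\<^sub>\<infinity>i. label_weight i * ?f (l i)) =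
        markov_step (G Mod N) label_weight (letter (G Mod N) b q) f (N #> k)"
      unfolding markov_step_def Nl[symmetric] using h.hom_mult[OF k l] by simp
    also have "\<dots> = f (N #> k)" using f[OF h.hom_closed[OF k]] by simp
    finally show "((\<lambda>g. \<mu> g * ?f g) has_sum f (N #> k)) (carrier G)" .
  qed
  moreover have "bounded_on G (\<lambda>x. f (N #> x))"
    unfolding bounded_on_def by (rule exI[of _ 1]) (use f[OF h.hom_closed] in fastforce)
  moreover have "\<exists>x\<in>carrier G. \<exists>y\<in>carrier G. f (N #> x) \<noteq> f (N #> y)"
    using ne unfolding carrier_FactGroup by blast
  ultimately have "\<not> liouville G \<mu>" unfolding liouville_def by blast
  moreover have "msupp G \<mu> = carrier G" using \<mu>_pos unfolding msupp_def by blast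
  moreover have "symmetric_measure G \<mu>" using sym unfolding symmetric_measure_def by blast
  moreover have "finite_entropy G \<mu>"
    unfolding finite_entropy_def \<mu>_def
    by (rule pushforward_entropy_summable[OF label_weight_pos label_weight_has_sum l label_entropy_summable])
  ultimately show ?thesis
    using prob by blast
qed

lemma (in group) full_support_imp_non_degenerate:
  assumes "msupp G \<mu> = carrier G"
  shows "non_degenerate G \<mu>"
proof -
  have "foldr (\<otimes>) xs \<one> \<in> carrier G" if "set xs \<subseteq> carrier G" for xs
    using that by (induction xs) auto
  moreover have "\<exists>xs. x = foldr (\<otimes>) xs \<one> \<and> xs \<noteq> [] \<and> set xs \<subseteq> carrier G" if "x \<in> carrier G" for x
    using that by (intro exI[of _ "[x]"]) auto
  ultimately show ?thesis unfolding non_degenerate_def semigroup_generated_def assms by blast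
qed

theorem theorem1:
  fixes G :: "'a monoid"
  assumes "group G" and "countable (carrier G)"
  shows "(choquet_deny G \<longleftrightarrow> \<not> has_icc_quotient G)
    \<and> (has_icc_quotient G \<longrightarrow>
         (\<exists>\<mu>. prob_measure_on G \<mu> \<and> msupp G \<mu> = carrier G \<and> symmetric_measure G \<mu>
              \<and> finite_entropy G \<mu> \<and> \<not> liouville G \<mu>))
    \<and> (finitely_generated G \<longrightarrow> (choquet_deny G \<longleftrightarrow> virtually_nilpotent G))"
proof -
  interpret group G by fact
  have icc: "\<exists>\<mu>. prob_measure_on G \<mu> \<and> msupp G \<mu> = carrier G \<and> symmetric_measure G \<mu>
              \<and> finite_entropy G \<mu> \<and> \<not> liouville G \<mu>" if "has_icc_quotient G"
    using icc_quotient_imp_not_liouville_measure[OF assms(2) that] .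
  then have "choquet_deny G \<longleftrightarrow> \<not> has_icc_quotient G"
    using no_icc_quotient_imp_choquet_deny full_support_imp_non_degenerate
    unfolding choquet_deny_def by blast
  then show ?thesis
    using icc no_icc_quotient_imp_virtually_nilpotent virtually_nilpotent_imp_no_icc_quotient by blast
qed

end
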